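(* Let $F$ be a Cartan (isoparametric) polynomial of degree $g$ on $\mathbb{R}^{n+2}$ with multiplicities $m_1,m_2$, let $f=F|_{S^{n+1}}$, and for $t\in(-1,1)$ let $Q_k$ and $\bar\rho_k$ be the functions of $t$ giving the (constant) values on $M_t=f^{-1}(t)$ of $\rho_k(S(t))$ and $\rho_k(H_F)|_{S^{n+1}}$, respectively. Then for $k=1,\dots,n-1$: $$Q_{k+1}=\frac{g}{k}\sqrt{1-t^2}\,\frac{dQ_k}{dt}-Q_{k-1},\qquad Q_0=n,\quad Q_1=\frac{m_1g}{2}\sqrt{\frac{1+t}{1-t}}-\frac{m_2g}{2}\sqrt{\frac{1-t}{1+t}};$$ $$\bar\rho_{k+1}=-\frac{g^2}{k}(1-t^2)\frac{d\bar\rho_k}{dt}-g(g-2)t\,\bar\rho_k+g^2(g-1)\bar\rho_{k-1}+\begin{cases}2g^{k+1}(g-1)^k(g-2), & k \text{ odd},\\ 2g^{k+1}(g-1)^k(g-2)\,t, & k\text{ even},\end{cases}$$ with $\bar\rho_0=n+2$ and $\bar\rho_1=\frac{g^2}{2}(m_2-m_1)$.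
   Context: A Cartan (isoparametric) polynomial is a homogeneous polynomial $F$ of degree $g$ on $\mathbb{R}^{n+2}$ satisfying the Cartan-Münzner equations $|\nabla F|^2=g^2|x|^{2g-2}$ and $\Delta F=\frac{g^2}{2}(m_2-m_1)|x|^{g-2}$, where the level hypersurfaces $M_t=f^{-1}(t)$, $t\in(-1,1)$, of $f=F|_{S^{n+1}}$ ($S^{n+1}$ the unit sphere) have $g$ distinct constant principal curvatures, and $m_1,m_2$ are the multiplicities of the maximal and minimal ones. $S(t)$ is the shape operator of $M_t$ with respect to $\nu=\nabla f/|\nabla f|$, i.e. $\langle S(t)X,Y\rangle=-H_f(X,Y)/|\nabla f|$ for $X,Y$ tangent to $M_t$, where $H_f$ is the Hessian of $f$ on $S^{n+1}$. $H_F$ is the Hessian of $F$ on $\mathbb{R}^{n+2}$. For a symmetric operator $A$ of order $N$, $\rho_k(A)=\mathrm{tr}(A^k)$ and $\rho_0(A)=N$. *)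

theory Defs
  imports "HOL-Analysis.Analysis"
begin

definition gradient :: "('a::euclidean_space \<Rightarrow> real) \<Rightarrow> 'a \<Rightarrow> 'a" where
  "gradient F x = (THE D. GDERIV F x :> D)"

text \<open>The Hessian as a self-adjoint operator: the associated bilinear form is
  \<open>\<langle>hessian F x X, Y\<rangle>\<close>.\<close>

definition hessian :: "('a::euclidean_space \<Rightarrow> real) \<Rightarrow> 'a \<Rightarrow> 'a \<Rightarrow> 'a" where
  "hessian F x = frechet_derivative (gradient F) (at x)"

definition laplacian :: "('a::euclidean_space \<Rightarrow> real) \<Rightarrow> 'a \<Rightarrow> real" where
  "laplacian F x = (\<Sum>b\<in>Basis. hessian F x b \<bullet> b)"

text \<open>For a linear operator \<open>A\<close> mapping the subspace \<open>V\<close> to itself, the value below does not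
  depend on the chosen orthonormal basis.  Values of \<open>A\<close> outside \<open>V\<close> are irrelevant.\<close>

definition orthonormal_basis_of :: "'a::euclidean_space set \<Rightarrow> 'a set \<Rightarrow> bool" where
  "orthonormal_basis_of V B \<longleftrightarrow>
     pairwise orthogonal B \<and> (\<forall>b\<in>B. norm b = 1) \<and> span B = V"

definition trace_on :: "'a::euclidean_space set \<Rightarrow> ('a \<Rightarrow> 'a) \<Rightarrow> real" where
  "trace_on V A = (\<Sum>b\<in>(SOME B. orthonormal_basis_of V B). A b \<bullet> b)"

definition rho :: "nat \<Rightarrow> 'a::euclidean_space set \<Rightarrow> ('a \<Rightarrow> 'a) \<Rightarrow> real" where
  "rho k V A = trace_on V (A ^^ k)"

text \<open>Calculus on the unit sphere.  A function or vector field on \<open>sphere 0 1\<close> is represented by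
  a function on the whole space of which only the values on the sphere matter: it is extended
  from the sphere to the punctured space so as to be constant on rays before it is differentiated.
  At points of the sphere, the gradient of this extension is the Riemannian gradient, and the
  tangential part of the derivative of an extended tangent field is its Levi-Civita derivative.\<close>

definition radial_ext :: "('a::euclidean_space \<Rightarrow> 'b) \<Rightarrow> 'a \<Rightarrow> 'b" where
  "radial_ext f y = f (y /\<^sub>R norm y)"

definition sphere_gradient :: "('a::euclidean_space \<Rightarrow> real) \<Rightarrow> 'a \<Rightarrow> 'a" where
  "sphere_gradient f x = gradient (radial_ext f) x"

text \<open>Meant for \<open>X\<close> and \<open>Y\<close> tangent to the sphere at \<open>x\<close>; pairing with such a \<open>Y\<close> makes the
  tangential projection in the Levi-Civita derivative superfluous.\<close>

definition sphere_hessian :: "('a::euclidean_space \<Rightarrow> real) \<Rightarrow> 'a \<Rightarrow> 'a \<Rightarrow> 'a \<Rightarrow> real" where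
  "sphere_hessian f x X Y =
     frechet_derivative (radial_ext (sphere_gradient f)) (at x) X \<bullet> Y"

definition level_hypersurface :: "('a::euclidean_space \<Rightarrow> real) \<Rightarrow> real \<Rightarrow> 'a set" where
  "level_hypersurface f t = {x \<in> sphere 0 1. f x = t}"

text \<open>Tangent space at \<open>x\<close> of the level hypersurface of \<open>f\<close> through \<open>x\<close>.\<close>

definition level_tangent :: "('a::euclidean_space \<Rightarrow> real) \<Rightarrow> 'a \<Rightarrow> 'a set" where
  "level_tangent f x = {X. X \<bullet> x = 0 \<and> X \<bullet> sphere_gradient f x = 0}"

definition shape_operator :: "('a::euclidean_space \<Rightarrow> real) \<Rightarrow> 'a \<Rightarrow> 'a \<Rightarrow> 'a" where
  "shape_operator f x X =
     (THE Z. Z \<in> level_tangent f x \<and>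
        (\<forall>Y\<in>level_tangent f x.
           Z \<bullet> Y = - sphere_hessian f x X Y / norm (sphere_gradient f x)))"

definition principal_space :: "('a::euclidean_space \<Rightarrow> real) \<Rightarrow> 'a \<Rightarrow> real \<Rightarrow> 'a set" where
  "principal_space f x \<kappa> = {X \<in> level_tangent f x. shape_operator f x X = \<kappa> *\<^sub>R X}"

definition principal_curvatures :: "('a::euclidean_space \<Rightarrow> real) \<Rightarrow> 'a \<Rightarrow> real set" where
  "principal_curvatures f x = {\<kappa>. \<exists>X\<in>principal_space f x \<kappa>. X \<noteq> 0}"

text \<open>The level sets are required to be nonempty in order to exclude \<open>F x = \<plusminus> norm x ^ g\<close> with
  \<open>g\<close> even, which solves both differential equations but has no level hypersurfaces.  Integer
  powers are used because \<open>g - 2\<close> is negative for \<open>g = 1\<close>.\<close>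

definition cartan_polynomial ::
  "('a::euclidean_space \<Rightarrow> real) \<Rightarrow> nat \<Rightarrow> nat \<Rightarrow> nat \<Rightarrow> bool" where
  "cartan_polynomial F g m1 m2 \<longleftrightarrow>
     real_polynomial_function F \<and>
     (\<forall>c x. F (c *\<^sub>R x) = c ^ g * F x) \<and>
     (\<forall>x. (norm (gradient F x))\<^sup>2 = (real g)\<^sup>2 * norm x powi (2 * int g - 2)) \<and>
     (\<forall>x. laplacian F x =
            (real g)\<^sup>2 / 2 * (real m2 - real m1) * norm x powi (int g - 2)) \<and>
     (\<forall>t\<in>{-1<..<1}. level_hypersurface F t \<noteq> {} \<and>
        (\<exists>K. finite K \<and> card K = g \<and>
           (\<forall>x\<in>level_hypersurface F t.
              principal_curvatures F x = K \<and>
              dim (principal_space F x (Max K)) = m1 \<and>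
              dim (principal_space F x (Min K)) = m2)))"

text \<open>The common value of a function on a level hypersurface, meaningful when the function is
  constant there.\<close>

definition level_value ::
  "('a::euclidean_space \<Rightarrow> real) \<Rightarrow> ('a \<Rightarrow> real) \<Rightarrow> real \<Rightarrow> real" where
  "level_value f h t = (THE q. \<forall>x\<in>level_hypersurface f t. h x = q)"

definition Q :: "('a::euclidean_space \<Rightarrow> real) \<Rightarrow> nat \<Rightarrow> real \<Rightarrow> real" where
  "Q F k = level_value F (\<lambda>x. rho k (level_tangent F x) (shape_operator F x))"

definition rho_bar :: "('a::euclidean_space \<Rightarrow> real) \<Rightarrow> nat \<Rightarrow> real \<Rightarrow> real" where
  "rho_bar F k = level_value F (\<lambda>x. rho k UNIV (hessian F x))"

end

(*
  Let H be the Hessian of F.  Differentiating the Euler relation and the first Cartan-Muenzner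
  equation shows that on the unit sphere the derivative of H in the direction of the gradient of
  F is a quadratic polynomial in H, up to a rank-one term.  Since the trace is cyclic, the
  derivative of tr (H^k) along the unit normal of the level hypersurfaces is a combination of
  tr (H^(k+1)), tr (H^k) and tr (H^(k-1)), so by induction these traces are polynomials in F
  and satisfy the second recursion.

  On the tangent space of the level F = t the shape operator is L = (t - H / g) / w, where
  w = sqrt (1 - t^2).  The recursion for the traces of H restricted to the tangent space turns
  into the trace form of the Riccati equation g w L' = 1 + L^2, which is the first recursion.

  The value of Q_1 requires n = g (m_1 + m_2) / 2.  The power sums of the numbers
  cot (arccos t / g + j pi / g), j < g, with weights that alternate between two values, satisfy
  the recursion for Q_k with the same initial values.  Hence they are the traces of the powers
  of the shape operator, whose eigenvalues and multiplicities can therefore be read off.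
*)
theory Submission
  imports Defs
begin

section \<open>Traces of operators\<close>

text \<open>The hypotheses give neither the multiplicities of the intermediate curvatures nor any
  smoothness of eigenvalues or eigenvectors. So nothing spectral is ever differentiated: only traces
  of powers are, and their derivatives at a point need just the third derivative of \<open>F\<close>
  there.

  The known derivatives concern powers of the Hessian, while the first recursion concerns powers of
  the shape operator, and a binomial expansion between the two would be unwieldy. The mixed traces
  \<open>gam k i\<close> of products of both operators form a family closed under differentiation in
  which the induction can run.

  Power sums then determine the spectrum by algebra alone. If the traces of all powers of a
  self-adjoint operator are weighted power sums of distinct numbers, suitable polynomials in the
  operator vanish or are eigenprojections. Since exactly \<open>g\<close> distinct curvatures exist,
  all \<open>g\<close> candidates occur, and the two extreme multiplicities give the dimension
  relation.\<close>

definition selfadjoint :: "('a::real_inner \<Rightarrow> 'a) \<Rightarrow> bool" where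
  "selfadjoint A \<longleftrightarrow> (\<forall>x y. A x \<bullet> y = x \<bullet> A y)"

text \<open>A trace over the fixed \<open>Basis\<close>: unlike the chosen basis in
  \<open>trace_on\<close>, it can be differentiated and reordered termwise.
  \<open>trace_on_UNIV\<close> links the two.\<close>

definition trace_op :: "('a::euclidean_space \<Rightarrow> 'a) \<Rightarrow> real" where
  "trace_op A = (\<Sum>b\<in>Basis. A b \<bullet> b)"

lemma trace_op_add: "trace_op (\<lambda>x. A x + B x) = trace_op A + trace_op B"
  and trace_op_diff: "trace_op (\<lambda>x. A x - B x) = trace_op A - trace_op B"
  and trace_op_scaleR: "trace_op (\<lambda>x. c *\<^sub>R A x) = c * trace_op A"
  and trace_op_minus: "trace_op (\<lambda>x. - A x) = - trace_op A"
  and trace_op_sum: "trace_op (\<lambda>x. \<Sum>i\<in>I. M i x) = (\<Sum>i\<in>I. trace_op (M i))"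
  unfolding trace_op_def
  by (simp_all add: inner_left_distrib inner_diff_left sum.distrib sum_subtractf sum_distrib_left
      inner_sum_left sum_negf) (rule sum.swap)

lemma trace_op_id: "trace_op (\<lambda>x. x :: 'a::euclidean_space) = DIM('a)"
  unfolding trace_op_def by (simp add: inner_same_Basis)

lemma linear_funpow: "linear (A ^^ k)" if "linear A" for A :: "'a::real_vector \<Rightarrow> 'a"
  by (induction k) (auto intro: linear_compose[unfolded o_def] that simp: linear_id[unfolded id_def] id_def o_def)

lemma trace_op_commute:
  fixes A B :: "'a::euclidean_space \<Rightarrow> 'a"
  assumes "linear A" "linear B"
  shows "trace_op (\<lambda>x. A (B x)) = trace_op (\<lambda>x. B (A x))"
proof -
  have expand: "A (B b) \<bullet> b = (\<Sum>c\<in>Basis. (B b \<bullet> c) * (A c \<bullet> b))"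
    if "linear A" for A B :: "'a \<Rightarrow> 'a" and b
  proof -
    have "A (B b) = A (\<Sum>c\<in>Basis. (B b \<bullet> c) *\<^sub>R c)"
      by (simp add: euclidean_representation)
    also have "\<dots> = (\<Sum>c\<in>Basis. (B b \<bullet> c) *\<^sub>R A c)"
      using that by (simp add: linear_sum linear_cmul)
    finally show ?thesis
      by (simp add: inner_sum_left)
  qed
  show ?thesis
    unfolding trace_op_def expand[OF assms(1), where B = B] expand[OF assms(2), where B = A]
    by (subst sum.swap) (simp add: mult.commute)
qed

lemma trace_op_rank_one: "trace_op (\<lambda>x. (x \<bullet> u) *\<^sub>R v) = u \<bullet> v"
  unfolding trace_op_def
  by (simp add: euclidean_inner[of u v] inner_commute mult.commute)

section \<open>Orthonormal bases and traces on subspaces\<close>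

lemma orthonormal_basis_of_finite: "orthonormal_basis_of V B \<Longrightarrow> finite B"
  unfolding orthonormal_basis_of_def by (simp add: pairwise_orthogonal_imp_finite)

lemma orthonormal_basis_of_expand:
  assumes "orthonormal_basis_of V B" "x \<in> V"
  shows "(\<Sum>b\<in>B. (x \<bullet> b) *\<^sub>R b) = x"
  using assms orthonormal_basis_of_finite[OF assms(1)]
  unfolding orthonormal_basis_of_def by (intro orthonormal_basis_expand) auto

lemma orthonormal_basis_of_parseval:
  assumes "orthonormal_basis_of V B" "x \<in> V"
  shows "(\<Sum>b\<in>B. (x \<bullet> b) * (y \<bullet> b)) = x \<bullet> y"
proof -
  have "x \<bullet> y = (\<Sum>b\<in>B. (x \<bullet> b) *\<^sub>R b) \<bullet> y"
    using assms by (simp add: orthonormal_basis_of_expand)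
  then show ?thesis
    by (simp add: inner_sum_left inner_commute[of y])
qed

lemma orthonormal_basis_of_exists:
  assumes "subspace V"
  shows "orthonormal_basis_of V (SOME B. orthonormal_basis_of V B)"
proof -
  obtain B where "B \<subseteq> V" "pairwise orthogonal B" "\<And>x. x \<in> B \<Longrightarrow> norm x = 1"
    "independent B" "card B = dim V" "span B = V"
    using orthonormal_basis_subspace[OF assms] by blast
  then have "orthonormal_basis_of V B"
    by (auto simp: orthonormal_basis_of_def)
  then show ?thesis
    by (rule someI)
qed

lemma orthonormal_basis_of_card: "card B = dim V" if "orthonormal_basis_of V B"
proof -
  have "0 \<notin> B"
    using that by (auto simp: orthonormal_basis_of_def)
  then have "independent B"
    using that pairwise_orthogonal_independent by (auto simp: orthonormal_basis_of_def)
  then show ?thesis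
    using that dim_span_eq_card_independent[of B] by (auto simp: orthonormal_basis_of_def)
qed

lemma trace_op_orthonormal_basis:
  fixes A :: "'a::euclidean_space \<Rightarrow> 'a"
  assumes "linear A" "orthonormal_basis_of UNIV B"
  shows "(\<Sum>b\<in>B. A b \<bullet> b) = trace_op A"
proof -
  have "(\<Sum>b\<in>B. A b \<bullet> b) = trace_op (\<lambda>x. \<Sum>b\<in>B. (x \<bullet> b) *\<^sub>R A b)"
    by (simp add: trace_op_sum trace_op_rank_one inner_commute[of _ "A _"])
  also have "(\<lambda>x. \<Sum>b\<in>B. (x \<bullet> b) *\<^sub>R A b) = A"
  proof
    fix x
    have "A x = A (\<Sum>b\<in>B. (x \<bullet> b) *\<^sub>R b)"
      using assms by (simp add: orthonormal_basis_of_expand)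
    also have "\<dots> = (\<Sum>b\<in>B. (x \<bullet> b) *\<^sub>R A b)"
      using assms by (simp add: linear_sum linear_cmul)
    finally show "(\<Sum>b\<in>B. (x \<bullet> b) *\<^sub>R A b) = A x" by simp
  qed
  finally show ?thesis .
qed

lemma trace_on_UNIV: "linear A \<Longrightarrow> trace_on UNIV A = trace_op A"
  unfolding trace_on_def
  by (rule trace_op_orthonormal_basis) (auto intro: orthonormal_basis_of_exists)

lemma subspace_orthogonal_pair: "subspace {X. X \<bullet> u = 0 \<and> X \<bullet> v = 0}"
  by (auto simp: subspace_def inner_left_distrib)

text \<open>An orthonormal basis of \<open>V\<close> becomes one of the whole space when
  \<open>u\<close> and \<open>v\<close> are added. In the application these are the position vector
  and the unit normal, so \<open>V\<close> is the tangent space of the level.\<close>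

lemma trace_on_orthogonal_pair:
  fixes A :: "'a::euclidean_space \<Rightarrow> 'a"
  assumes A: "linear A" and uv: "norm u = 1" "norm v = 1" "u \<bullet> v = 0"
    and V: "V = {X. X \<bullet> u = 0 \<and> X \<bullet> v = 0}"
  shows "trace_on V A = trace_op A - A u \<bullet> u - A v \<bullet> v"
proof -
  have "subspace V"
    unfolding V by (rule subspace_orthogonal_pair)
  define B where "B = (SOME B. orthonormal_basis_of V B)"
  have B: "orthonormal_basis_of V B"
    unfolding B_def by (rule orthonormal_basis_of_exists) fact
  then have BV: "B \<subseteq> V"
    by (auto simp: orthonormal_basis_of_def span_base)
  have sq: "u \<bullet> u = 1" "v \<bullet> v = 1"
    using uv by (auto simp: norm_eq_1)
  have notin: "u \<notin> B" "v \<notin> B" "u \<noteq> v"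
    using BV sq uv(3) by (auto simp: V)
  have "span (insert u (insert v B)) = UNIV"
  proof -
    have "x \<in> span (insert u (insert v B))" for x
    proof -
      have "x - (x \<bullet> u) *\<^sub>R u - (x \<bullet> v) *\<^sub>R v \<in> V"
        using uv(3) by (simp add: V inner_diff_left sq inner_commute[of v u])
      then have "x - (x \<bullet> u) *\<^sub>R u - (x \<bullet> v) *\<^sub>R v \<in> span (insert u (insert v B))"
        using B span_mono[of B "insert u (insert v B)"] by (auto simp: orthonormal_basis_of_def)
      then have "(x - (x \<bullet> u) *\<^sub>R u - (x \<bullet> v) *\<^sub>R v) + (x \<bullet> v) *\<^sub>R v + (x \<bullet> u) *\<^sub>R u
          \<in> span (insert u (insert v B))"
        by (intro span_add span_scale) (auto intro: span_base)
      then show ?thesis by simp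
    qed
    then show ?thesis by auto
  qed
  then have "orthonormal_basis_of UNIV (insert u (insert v B))"
    using B BV uv unfolding orthonormal_basis_of_def
    by (auto simp: pairwise_insert orthogonal_def V inner_commute)
  from trace_op_orthonormal_basis[OF A this]
  have "A u \<bullet> u + (A v \<bullet> v + (\<Sum>b\<in>B. A b \<bullet> b)) = trace_op A"
    using orthonormal_basis_of_finite[OF B] notin by simp
  then show ?thesis
    by (simp add: trace_on_def B_def)
qed

lemma trace_on_cong:
  assumes "subspace V" "\<And>X. X \<in> V \<Longrightarrow> A X = B X"
  shows "trace_on V A = trace_on V B"
proof -
  have "b \<in> V" if "b \<in> (SOME B. orthonormal_basis_of V B)" for b
    using that orthonormal_basis_of_exists[OF assms(1)]
    by (auto simp: orthonormal_basis_of_def span_base)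
  then show ?thesis
    unfolding trace_on_def using assms(2) by (intro sum.cong) auto
qed

lemma trace_on_diff: "trace_on V (\<lambda>x. A x - B x) = trace_on V A - trace_on V B"
  and trace_on_scaleR: "trace_on V (\<lambda>x. c *\<^sub>R A x) = c * trace_on V A"
  unfolding trace_on_def
  by (simp_all add: inner_left_distrib inner_diff_left sum.distrib sum_subtractf sum_distrib_left)

text \<open>If \<open>P\<close> is the orthogonal projection of \<open>V\<close> onto \<open>E\<close>, then \<open>P b \<bullet> b = (\<Sum>c. (b \<bullet> c)\<^sup>2)\<close>
  for an orthonormal basis \<open>c\<close> of \<open>E\<close>, and the sum over \<open>b\<close> counts the \<open>c\<close>.\<close>

lemma trace_on_projection:
  fixes P :: "'a::euclidean_space \<Rightarrow> 'a"
  assumes V: "subspace V" and E: "subspace E" "E \<subseteq> V"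
    and P: "selfadjoint P" "\<And>X. X \<in> V \<Longrightarrow> P X \<in> E" "\<And>X. X \<in> E \<Longrightarrow> P X = X"
  shows "trace_on V P = dim E"
proof -
  define B C where "B = (SOME B. orthonormal_basis_of V B)" "C = (SOME B. orthonormal_basis_of E B)"
  have B: "orthonormal_basis_of V B" and C: "orthonormal_basis_of E C"
    unfolding B_C_def using V E by (auto intro: orthonormal_basis_of_exists)
  have BV: "b \<in> V" if "b \<in> B" for b
    using B that by (auto simp: orthonormal_basis_of_def span_base)
  have CE: "c \<in> E" "c \<bullet> c = 1" if "c \<in> C" for c
    using C that by (auto simp: orthonormal_basis_of_def span_base norm_eq_1)
  have "P b \<bullet> b = (\<Sum>c\<in>C. (c \<bullet> b) * (c \<bullet> b))" if "b \<in> B" for b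
  proof -
    have "P b \<bullet> b = (\<Sum>c\<in>C. (P b \<bullet> c) * (b \<bullet> c))"
      using orthonormal_basis_of_parseval[OF C, of "P b" b] P(2) BV that by simp
    also have "\<dots> = (\<Sum>c\<in>C. (c \<bullet> b) * (c \<bullet> b))"
      using P(1,3) CE by (intro sum.cong) (auto simp: selfadjoint_def inner_commute[of _ b])
    finally show ?thesis .
  qed
  then have "trace_on V P = (\<Sum>b\<in>B. \<Sum>c\<in>C. (c \<bullet> b) * (c \<bullet> b))"
    by (simp add: trace_on_def B_C_def)
  also have "\<dots> = (\<Sum>c\<in>C. \<Sum>b\<in>B. (c \<bullet> b) * (c \<bullet> b))"
    by (rule sum.swap)
  also have "\<dots> = (\<Sum>c\<in>C. 1)"
    using orthonormal_basis_of_parseval[OF B] CE E(2) by (intro sum.cong refl) (simp add: subset_iff)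
  finally show ?thesis
    using orthonormal_basis_of_card[OF C] by simp
qed

section \<open>Polynomials in a self-adjoint operator, given by their roots\<close>

primrec root_product :: "real list \<Rightarrow> ('a::real_vector \<Rightarrow> 'a) \<Rightarrow> 'a \<Rightarrow> 'a" where
  "root_product [] L X = X"
| "root_product (c # cs) L X = L (root_product cs L X) - c *\<^sub>R root_product cs L X"

lemma linear_root_product: "linear L \<Longrightarrow> linear (root_product cs L)"
proof (induction cs)
  case Nil
  then show ?case by (simp add: linear_id[unfolded id_def])
next
  case (Cons c cs)
  then have "linear (\<lambda>X. L (root_product cs L X) - c *\<^sub>R root_product cs L X)"
    by (intro linear_compose_sub linear_compose_scale_right)
      (auto intro: linear_compose[unfolded o_def])
  then show ?case by simp
qed

lemma root_product_commute:
  assumes "linear L"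
  shows "root_product cs L (L X) = L (root_product cs L X)"
  using assms by (induction cs) (auto simp: linear_diff linear_cmul)

lemma root_product_append: "root_product (cs @ ds) L X = root_product cs L (root_product ds L X)"
  by (induction cs) auto

lemma selfadjoint_root_product:
  assumes "linear L" "selfadjoint L"
  shows "selfadjoint (root_product cs L)"
  using assms
  by (induction cs)
    (auto simp: selfadjoint_def inner_diff_left inner_diff_right root_product_commute
      linear_root_product linear_diff linear_cmul)

lemma root_product_mem:
  assumes "subspace V" "\<And>X. X \<in> V \<Longrightarrow> L X \<in> V" "X \<in> V"
  shows "root_product cs L X \<in> V"
  using assms by (induction cs) (auto intro: subspace_diff subspace_scale)

lemma root_product_eigenvector:
  assumes "linear L" "L X = \<kappa> *\<^sub>R X"
  shows "root_product cs L X = prod_list (map (\<lambda>c. \<kappa> - c) cs) *\<^sub>R X"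
  using assms by (induction cs) (auto simp: linear_cmul algebra_simps)

lemma trace_on_root_product:
  fixes L :: "'a::euclidean_space \<Rightarrow> 'a"
  assumes L: "linear L"
    and tr: "\<And>k. trace_on V (L ^^ k) = (\<Sum>j\<in>J. w j * c j ^ k)"
  shows "trace_on V (root_product cs L) = (\<Sum>j\<in>J. w j * prod_list (map (\<lambda>a. c j - a) cs))"
proof -
  \<comment> \<open>The extra power of \<open>L\<close> carries the induction: peeling off a root
    \<open>a\<close> leads to the traces with \<open>Suc k\<close> and with
    \<open>k\<close>.\<close>
  have "trace_on V (\<lambda>X. root_product cs L ((L ^^ k) X))
      = (\<Sum>j\<in>J. w j * (prod_list (map (\<lambda>a. c j - a) cs) * c j ^ k))" for k
  proof (induction cs arbitrary: k)
    case Nil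
    then show ?case using tr by simp
  next
    case (Cons a cs)
    have "trace_on V (\<lambda>X. root_product (a # cs) L ((L ^^ k) X)) =
       trace_on V (\<lambda>X. root_product cs L ((L ^^ Suc k) X) - a *\<^sub>R root_product cs L ((L ^^ k) X))"
      by (simp add: root_product_commute[OF L])
    also have "\<dots> = (\<Sum>j\<in>J. w j * (prod_list (map (\<lambda>a. c j - a) cs) * c j ^ Suc k)) -
        a * (\<Sum>j\<in>J. w j * (prod_list (map (\<lambda>a. c j - a) cs) * c j ^ k))"
      unfolding trace_on_diff trace_on_scaleR Cons.IH ..
    also have "\<dots> = (\<Sum>j\<in>J. w j * (prod_list (map (\<lambda>b. c j - b) (a # cs)) * c j ^ k))"
      by (simp add: sum_distrib_left sum_subtractf[symmetric] algebra_simps)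
    finally show ?case .
  qed
  from this[of 0] show ?thesis by simp
qed

text \<open>Doubling the list squares the operator. By self-adjointness the trace of the square is
  the sum of the squared norms of the images of an orthonormal basis; it is zero because the
  polynomial vanishes at every \<open>c j\<close>.\<close>

lemma root_product_eq_0:
  fixes L :: "'a::euclidean_space \<Rightarrow> 'a"
  assumes L: "linear L" "selfadjoint L" and V: "subspace V" "\<And>X. X \<in> V \<Longrightarrow> L X \<in> V"
    and tr: "\<And>k. trace_on V (L ^^ k) = (\<Sum>j\<in>J. w j * c j ^ k)"
    and cs: "\<And>j. j \<in> J \<Longrightarrow> c j \<in> set cs" and "X \<in> V"
  shows "root_product cs L X = 0"
proof -
  let ?R = "root_product cs L"
  define B where "B = (SOME B. orthonormal_basis_of V B)"
  have B: "orthonormal_basis_of V B"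
    unfolding B_def by (rule orthonormal_basis_of_exists) fact
  have "prod_list (map (\<lambda>a. c j - a) (cs @ cs)) = 0" if "j \<in> J" for j
    using cs[OF that] by (auto simp: prod_list_zero_iff)
  then have "trace_on V (root_product (cs @ cs) L) = 0"
    using trace_on_root_product[OF L(1) tr, where cs = "cs @ cs"] by (simp del: map_append)
  moreover have "trace_on V (root_product (cs @ cs) L) = (\<Sum>b\<in>B. ?R b \<bullet> ?R b)"
    using selfadjoint_root_product[OF L, of cs]
    by (simp add: trace_on_def B_def root_product_append selfadjoint_def)
  ultimately have R0: "?R b = 0" if "b \<in> B" for b
    using that orthonormal_basis_of_finite[OF B] by (simp add: sum_nonneg_eq_0_iff)
  have "X = (\<Sum>b\<in>B. (X \<bullet> b) *\<^sub>R b)"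
    using orthonormal_basis_of_expand[OF B \<open>X \<in> V\<close>] by simp
  then have "?R X = ?R (\<Sum>b\<in>B. (X \<bullet> b) *\<^sub>R b)"
    by (rule arg_cong)
  also have "\<dots> = (\<Sum>b\<in>B. (X \<bullet> b) *\<^sub>R ?R b)"
    using linear_root_product[OF L(1), of cs] by (simp add: linear_sum linear_cmul)
  finally show ?thesis using R0 by simp
qed

text \<open>Lagrange interpolation: the product over the other roots, divided by its value
  \<open>d\<close> at \<open>c i\<close>, is the orthogonal projection onto the eigenspace. Its
  trace is the dimension, and by the power sums it is also \<open>w i\<close>.\<close>

lemma dim_eigenspace_root_product:
  fixes L :: "'a::euclidean_space \<Rightarrow> 'a"
  assumes L: "linear L" "selfadjoint L" and V: "subspace V" "\<And>X. X \<in> V \<Longrightarrow> L X \<in> V"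
    and tr: "\<And>k. trace_on V (L ^^ k) = (\<Sum>j\<in>J. w j * c j ^ k)"
    and J: "finite J" "inj_on c J" "i \<in> J"
  shows "real (dim {X\<in>V. L X = c i *\<^sub>R X}) = w i"
proof -
  define E where "E = {X\<in>V. L X = c i *\<^sub>R X}"
  obtain cs where cs: "set cs = c ` (J - {i})" "distinct cs"
    using finite_distinct_list[of "c ` (J - {i})"] J by auto
  define d where "d = prod_list (map (\<lambda>a. c i - a) cs)"
  have "c i \<notin> set cs"
    unfolding cs using J by (auto simp: inj_on_def)
  then have "d \<noteq> 0"
    by (auto simp: d_def prod_list_zero_iff)
  define P where "P X = (1 / d) *\<^sub>R root_product cs L X" for X
  have "trace_on V P = real (dim E)"
  proof (rule trace_on_projection)
    show "subspace E"
      using V L unfolding E_def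
      by (auto simp: subspace_def linear_add linear_cmul linear_0 algebra_simps)
    show "selfadjoint P"
      using selfadjoint_root_product[OF L, of cs] by (simp add: P_def selfadjoint_def)
    show "P X = X" if "X \<in> E" for X
      using root_product_eigenvector[OF L(1), of X "c i" cs] that \<open>d \<noteq> 0\<close>
      by (auto simp: E_def P_def d_def)
    show "P X \<in> E" if "X \<in> V" for X
    proof -
      have "root_product (c i # cs) L X = 0"
        by (rule root_product_eq_0[OF L V tr _ that]) (auto simp: cs)
      then have "L (root_product cs L X) = c i *\<^sub>R root_product cs L X"
        by simp
      moreover have "root_product cs L X \<in> V"
        by (rule root_product_mem) (use V that in auto)
      ultimately show ?thesis
        using V(1) L(1) by (simp add: E_def P_def subspace_scale linear_cmul)
    qed
  qed (auto simp: E_def V)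
  moreover have "trace_on V P = 1 / d * (\<Sum>j\<in>J. w j * prod_list (map (\<lambda>a. c j - a) cs))"
    unfolding P_def by (simp only: trace_on_scaleR trace_on_root_product[OF L(1) tr])
  moreover have "(\<Sum>j\<in>J. w j * prod_list (map (\<lambda>a. c j - a) cs)) = (\<Sum>j\<in>J. if j = i then w i * d else 0)"
  proof (intro sum.cong refl)
    fix j assume "j \<in> J"
    have "j \<noteq> i \<Longrightarrow> c j \<in> set cs"
      using \<open>j \<in> J\<close> by (auto simp: cs)
    then show "w j * prod_list (map (\<lambda>a. c j - a) cs) = (if j = i then w i * d else 0)"
      by (auto simp: d_def prod_list_zero_iff)
  qed
  ultimately show ?thesis
    using J \<open>d \<noteq> 0\<close> by (simp add: E_def)
qed

text \<open>Cyclicity of the trace collects the \<open>k\<close> terms of the Leibniz rule for \<open>M r ^^ k\<close>.\<close>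

lemma has_derivative_funpow_trace:
  fixes M :: "real \<Rightarrow> 'a::euclidean_space \<Rightarrow> 'a"
  assumes M: "\<And>r. linear (M r)"
    and M': "\<And>u. ((\<lambda>r. M r u) has_vector_derivative M' u) (at 0)"
  shows "((\<lambda>r. trace_op (M r ^^ k)) has_real_derivative
            real k * trace_op (\<lambda>u. (M 0 ^^ (k - 1)) (M' u))) (at 0)"
proof -
  have linM': "linear M'"
  proof
    fix u v :: 'a and c :: real
    have "((\<lambda>r. M r u + M r v) has_vector_derivative M' u + M' v) (at 0)"
      by (intro has_vector_derivative_add M')
    moreover have "(\<lambda>r. M r u + M r v) = (\<lambda>r. M r (u + v))"
      using M by (simp add: linear_add)
    ultimately show "M' (u + v) = M' u + M' v"
      using vector_derivative_unique_at[OF M'[of "u + v"]] by metis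
    have "((\<lambda>r. c *\<^sub>R M r u) has_vector_derivative c *\<^sub>R M' u) (at 0)"
      by (intro M' bounded_linear.has_vector_derivative[OF bounded_linear_scaleR_right])
    moreover have "(\<lambda>r. c *\<^sub>R M r u) = (\<lambda>r. M r (c *\<^sub>R u))"
      using M by (simp add: linear_cmul)
    ultimately show "M' (c *\<^sub>R u) = c *\<^sub>R M' u"
      using vector_derivative_unique_at[OF M'[of "c *\<^sub>R u"]] by metis
  qed
  \<comment> \<open>\<open>M\<close> is differentiable only pointwise. Expanding the moving argument
    in the finite basis leaves a sum of products of differentiable functions.\<close>
  have prod: "((\<lambda>r. M r (y r)) has_vector_derivative M 0 y' + M' (y 0)) (at 0)"
    if "(y has_vector_derivative y') (at 0)" for y y'
  proof -
    have eq: "M r z = (\<Sum>b\<in>Basis. (z \<bullet> b) *\<^sub>R M r b)" for r z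
    proof -
      have "M r z = M r (\<Sum>b\<in>Basis. (z \<bullet> b) *\<^sub>R b)"
        by (simp add: euclidean_representation)
      also have "\<dots> = (\<Sum>b\<in>Basis. (z \<bullet> b) *\<^sub>R M r b)"
        using M[of r] by (simp add: linear_sum linear_cmul)
      finally show ?thesis .
    qed
    have eq': "M' z = (\<Sum>b\<in>Basis. (z \<bullet> b) *\<^sub>R M' b)" for z
    proof -
      have "M' z = M' (\<Sum>b\<in>Basis. (z \<bullet> b) *\<^sub>R b)"
        by (simp add: euclidean_representation)
      also have "\<dots> = (\<Sum>b\<in>Basis. (z \<bullet> b) *\<^sub>R M' b)"
        using linM' by (simp add: linear_sum linear_cmul)
      finally show ?thesis .
    qed
    have yb: "((\<lambda>r. y r \<bullet> b) has_real_derivative y' \<bullet> b) (at 0)" for b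
      using bounded_linear.has_vector_derivative[OF bounded_linear_inner_left that]
      by (simp add: has_real_derivative_iff_has_vector_derivative)
    have "((\<lambda>r. \<Sum>b\<in>Basis. (y r \<bullet> b) *\<^sub>R M r b) has_vector_derivative
        (\<Sum>b\<in>Basis. (y 0 \<bullet> b) *\<^sub>R M' b + (y' \<bullet> b) *\<^sub>R M 0 b)) (at 0)"
      by (intro has_vector_derivative_sum has_vector_derivative_scaleR yb M')
    then show ?thesis
      unfolding eq[symmetric] sum.distrib eq'[symmetric] by (simp add: add.commute)
  qed
  have pow: "((\<lambda>r. (M r ^^ k) u) has_vector_derivative
      (\<Sum>j<k. (M 0 ^^ j) (M' ((M 0 ^^ (k - 1 - j)) u)))) (at 0)" for u
  proof (induction k)
    case 0
    then show ?case by simp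
  next
    case (Suc k)
    have "M 0 (\<Sum>j<k. (M 0 ^^ j) (M' ((M 0 ^^ (k - 1 - j)) u))) + M' ((M 0 ^^ k) u) =
      (\<Sum>j<Suc k. (M 0 ^^ j) (M' ((M 0 ^^ (Suc k - 1 - j)) u)))"
      unfolding sum.lessThan_Suc_shift using M[of 0] by (simp add: linear_sum)
    then show ?case
      using prod[OF Suc] by simp
  qed
  have cyc: "trace_op (\<lambda>u. (M 0 ^^ j) (M' ((M 0 ^^ (k - 1 - j)) u)))
      = trace_op (\<lambda>u. (M 0 ^^ (k - 1)) (M' u))" if "j < k" for j
  proof -
    have "trace_op (\<lambda>u. (M 0 ^^ j) (M' ((M 0 ^^ (k - 1 - j)) u))) =
      trace_op (\<lambda>u. (M 0 ^^ (k - 1 - j)) ((M 0 ^^ j) (M' u)))"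
      by (rule trace_op_commute[of "\<lambda>u. (M 0 ^^ j) (M' u)"])
        (auto intro: linear_funpow M linM' linear_compose[unfolded o_def])
    also have "\<dots> = trace_op (\<lambda>u. (M 0 ^^ (k - 1)) (M' u))"
    proof -
      have "(M 0 ^^ (k - 1)) v = (M 0 ^^ (k - 1 - j)) ((M 0 ^^ j) v)" for v
        using funpow_add[of "k - 1 - j" j "M 0"] that by simp
      then show ?thesis by simp
    qed
    finally show ?thesis .
  qed
  have "((\<lambda>r. trace_op (M r ^^ k)) has_real_derivative
      trace_op (\<lambda>u. \<Sum>j<k. (M 0 ^^ j) (M' ((M 0 ^^ (k - 1 - j)) u)))) (at 0)"
    unfolding trace_op_def has_real_derivative_iff_has_vector_derivative
    by (intro has_vector_derivative_sum bounded_linear.has_vector_derivative[OF bounded_linear_inner_left pow])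
  then show ?thesis
    by (simp add: trace_op_sum cyc[simplified])
qed

section \<open>Derivatives of polynomial functions\<close>

lemma gradient_eqI: "gradient f x = D" if "(f has_derivative (\<lambda>u. D \<bullet> u)) (at x)"
  unfolding gradient_def
proof (rule the_equality)
  show "GDERIV f x :> D"
    using that by (simp add: gderiv_def inner_commute)
  fix E assume "GDERIV f x :> E"
  then have "(f has_derivative (\<lambda>u. E \<bullet> u)) (at x)"
    by (simp add: gderiv_def inner_commute)
  then have "(\<lambda>u. E \<bullet> u) = (\<lambda>u. D \<bullet> u)"
    using that by (rule has_derivative_unique)
  then show "E = D"
    by (metis vector_eq_rdot inner_commute)
qed

text \<open>The components of the derivative are polynomials again, so the result can be iterated up
  to the third derivative.\<close>

lemma real_polynomial_function_derivative:
  fixes p :: "'a::euclidean_space \<Rightarrow> real"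
  assumes "real_polynomial_function p"
  shows "\<exists>G. (\<forall>x. (p has_derivative (\<lambda>u. G x \<bullet> u)) (at x)) \<and>
    (\<forall>u. real_polynomial_function (\<lambda>x. G x \<bullet> u))"
  using assms
proof induction
  case (linear f)
  define D where "D = (\<Sum>b\<in>Basis. f b *\<^sub>R b)"
  have "f u = D \<bullet> u" for u
  proof -
    have "f u = f (\<Sum>b\<in>Basis. (u \<bullet> b) *\<^sub>R b)"
      by (simp add: euclidean_representation)
    also have "\<dots> = (\<Sum>b\<in>Basis. (u \<bullet> b) * f b)"
      using linear by (simp add: linear_sum linear_cmul bounded_linear.linear)
    finally show ?thesis
      by (simp add: D_def inner_sum_left inner_sum_right inner_commute mult.commute)
  qed
  then have "f = (\<lambda>u. D \<bullet> u)" by blast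
  with linear have "(f has_derivative (\<lambda>u. D \<bullet> u)) (at x)" for x
    by (simp add: bounded_linear_imp_has_derivative)
  then show ?case
    by (intro exI[of _ "\<lambda>_. D"]) auto
next
  case (const c)
  show ?case
    by (intro exI[of _ "\<lambda>_. 0"]) auto
next
  case (add f g)
  then obtain G K where
    "\<And>x. (f has_derivative (\<lambda>u. G x \<bullet> u)) (at x)" "\<And>u. real_polynomial_function (\<lambda>x. G x \<bullet> u)"
    "\<And>x. (g has_derivative (\<lambda>u. K x \<bullet> u)) (at x)" "\<And>u. real_polynomial_function (\<lambda>x. K x \<bullet> u)"
    by blast
  then show ?case
    by (intro exI[of _ "\<lambda>x. G x + K x"])
      (auto simp: inner_add_left intro: has_derivative_add)
next
  case (mult f g)
  then obtain G K where *:
    "\<And>x. (f has_derivative (\<lambda>u. G x \<bullet> u)) (at x)" "\<And>u. real_polynomial_function (\<lambda>x. G x \<bullet> u)"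
    "\<And>x. (g has_derivative (\<lambda>u. K x \<bullet> u)) (at x)" "\<And>u. real_polynomial_function (\<lambda>x. K x \<bullet> u)"
    by blast
  have "((\<lambda>x. f x * g x) has_derivative (\<lambda>u. (f x *\<^sub>R K x + g x *\<^sub>R G x) \<bullet> u)) (at x)" for x
    by (rule has_derivative_eq_rhs[OF has_derivative_mult[OF *(1) *(3)]])
      (auto simp: inner_add_left algebra_simps)
  moreover have "real_polynomial_function (\<lambda>x. (f x *\<^sub>R K x + g x *\<^sub>R G x) \<bullet> u)" for u
    unfolding inner_add_left inner_scaleR_left
    by (intro real_polynomial_function.intros(3,4) *(2,4) mult(1,2))
  ultimately show ?case
    by (intro exI[of _ "\<lambda>x. f x *\<^sub>R K x + g x *\<^sub>R G x"]) auto
qed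

context
  fixes p :: "'a::euclidean_space \<Rightarrow> real"
  assumes p: "real_polynomial_function p"
begin

lemma poly_has_derivative_gradient: "(p has_derivative (\<lambda>u. gradient p x \<bullet> u)) (at x)"
  and real_polynomial_function_gradient: "real_polynomial_function (\<lambda>x. gradient p x \<bullet> u)"
proof -
  obtain G where G: "\<And>x. (p has_derivative (\<lambda>u. G x \<bullet> u)) (at x)"
    "\<And>u. real_polynomial_function (\<lambda>x. G x \<bullet> u)"
    using real_polynomial_function_derivative[OF p] by blast
  then have "gradient p = G"
    by (intro ext gradient_eqI)
  with G show "(p has_derivative (\<lambda>u. gradient p x \<bullet> u)) (at x)"
    "real_polynomial_function (\<lambda>x. gradient p x \<bullet> u)" by auto
qed

end

lemma has_derivative_componentwiseI:
  fixes f :: "'a::real_normed_vector \<Rightarrow> 'b::euclidean_space"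
  assumes "\<And>b. b \<in> Basis \<Longrightarrow> ((\<lambda>x. f x \<bullet> b) has_derivative d b) (at x)"
  shows "(f has_derivative (\<lambda>u. \<Sum>b\<in>Basis. d b u *\<^sub>R b)) (at x)"
proof -
  have "((\<lambda>x. \<Sum>b\<in>Basis. (f x \<bullet> b) *\<^sub>R b) has_derivative (\<lambda>u. \<Sum>b\<in>Basis. d b u *\<^sub>R b)) (at x)"
    by (intro has_derivative_sum has_derivative_scaleR_left assms)
  then show ?thesis
    by (simp add: euclidean_representation)
qed

context
  fixes p :: "'a::euclidean_space \<Rightarrow> real"
  assumes p: "real_polynomial_function p"
begin

lemma poly_gradient_has_derivative: "(gradient p has_derivative hessian p x) (at x)"
proof -
  have "(gradient p has_derivative
      (\<lambda>u. \<Sum>b\<in>Basis. (gradient (\<lambda>x. gradient p x \<bullet> b) x \<bullet> u) *\<^sub>R b)) (at x)"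
    by (intro has_derivative_componentwiseI poly_has_derivative_gradient
        real_polynomial_function_gradient p)
  then show ?thesis
    unfolding hessian_def by (intro frechet_derivative_works[THEN iffD1]) (auto simp: differentiable_def)
qed

lemma linear_hessian: "linear (hessian p x)"
  using poly_gradient_has_derivative has_derivative_linear by blast

lemma hessian_inner: "hessian p x u \<bullet> v = gradient (\<lambda>x. gradient p x \<bullet> v) x \<bullet> u"
proof -
  have "((\<lambda>x. gradient p x \<bullet> v) has_derivative (\<lambda>u. hessian p x u \<bullet> v)) (at x)"
    by (intro has_derivative_inner_left poly_gradient_has_derivative)
  moreover have "((\<lambda>x. gradient p x \<bullet> v) has_derivative (\<lambda>u. gradient (\<lambda>x. gradient p x \<bullet> v) x \<bullet> u)) (at x)"
    by (intro poly_has_derivative_gradient real_polynomial_function_gradient p)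
  ultimately show ?thesis
    using has_derivative_unique by metis
qed

lemma real_polynomial_function_hessian: "real_polynomial_function (\<lambda>x. hessian p x u \<bullet> v)"
  unfolding hessian_inner by (intro real_polynomial_function_gradient p)

end

lemma hessian_inner_eqI:
  assumes "real_polynomial_function p" "((\<lambda>x. gradient p x \<bullet> v) has_derivative d) (at x)"
  shows "hessian p x u \<bullet> v = d u"
proof -
  have "((\<lambda>x. gradient p x \<bullet> v) has_derivative (\<lambda>u. hessian p x u \<bullet> v)) (at x)"
    by (intro has_derivative_inner_left poly_gradient_has_derivative assms(1))
  then show ?thesis
    using has_derivative_unique[OF assms(2)] by metis
qed

text \<open>Symmetry passes through the construction of polynomials: in a product, the two mixed
  terms in first derivatives are exchanged by swapping \<open>u\<close> and
  \<open>v\<close>.\<close>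

lemma hessian_commute:
  assumes "real_polynomial_function p"
  shows "hessian p x u \<bullet> v = hessian p x v \<bullet> u"
  using assms
proof (induction arbitrary: u v)
  case (linear f)
  obtain D where D: "\<And>x. (f has_derivative (\<lambda>u. D \<bullet> u)) (at x)"
  proof -
    have "(f has_derivative (\<lambda>u. gradient f 0 \<bullet> u)) (at 0)"
      using linear by (intro poly_has_derivative_gradient) auto
    then have "f = (\<lambda>u. gradient f 0 \<bullet> u)"
      using linear bounded_linear_imp_has_derivative has_derivative_unique by blast
    then show ?thesis
      using that[of "gradient f 0"] linear bounded_linear_imp_has_derivative by metis
  qed
  then have "gradient f = (\<lambda>_. D)"
    by (intro ext gradient_eqI)
  then have "hessian f x u \<bullet> v = 0" for u v
    using linear by (intro hessian_inner_eqI) auto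
  then show ?case by simp
next
  case (const c)
  have "gradient (\<lambda>_. c) = (\<lambda>_. 0 :: 'a)"
    by (intro ext gradient_eqI) auto
  then have "hessian (\<lambda>_ :: 'a. c) x u \<bullet> v = 0" for u v
    by (intro hessian_inner_eqI) auto
  then show ?case by simp
next
  case (add f g)
  have grad: "gradient (\<lambda>x. f x + g x) = (\<lambda>x. gradient f x + gradient g x)"
    by (intro ext gradient_eqI)
      (auto simp: inner_add_left add intro!: has_derivative_add poly_has_derivative_gradient)
  have "hessian (\<lambda>x. f x + g x) x u \<bullet> v = hessian f x u \<bullet> v + hessian g x u \<bullet> v" for u v
    using add(1,2) unfolding grad inner_add_left
    by (intro hessian_inner_eqI)
      (auto simp: grad inner_add_left intro!: has_derivative_add has_derivative_inner_left poly_gradient_has_derivative)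
  then show ?case
    using add.IH by simp
next
  case (mult f g)
  have grad: "gradient (\<lambda>x. f x * g x) = (\<lambda>x. f x *\<^sub>R gradient g x + g x *\<^sub>R gradient f x)"
    by (intro ext gradient_eqI
        has_derivative_eq_rhs[OF has_derivative_mult[OF poly_has_derivative_gradient poly_has_derivative_gradient]])
      (auto simp: inner_add_left mult)
  have "hessian (\<lambda>x. f x * g x) x u \<bullet> v =
     (f x * (hessian g x u \<bullet> v) + (gradient f x \<bullet> u) * (gradient g x \<bullet> v)) +
     (g x * (hessian f x u \<bullet> v) + (gradient g x \<bullet> u) * (gradient f x \<bullet> v))" for u v
    using mult(1,2)
    by (intro hessian_inner_eqI)
      (auto simp: grad inner_add_left
        intro!: has_derivative_add has_derivative_mult has_derivative_inner_left
          poly_has_derivative_gradient poly_gradient_has_derivative)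
  then show ?case
    using mult.IH by (simp add: mult.commute)
qed

text \<open>The trilinear third derivative with one slot turned into a vector by the inner product:
  \<open>u\<close> is the argument of the Hessian, the remaining argument is the direction of
  differentiation.\<close>

definition third_derivative :: "('a::euclidean_space \<Rightarrow> real) \<Rightarrow> 'a \<Rightarrow> 'a \<Rightarrow> 'a \<Rightarrow> 'a" where
  "third_derivative p x u = frechet_derivative (\<lambda>x. hessian p x u) (at x)"

context
  fixes p :: "'a::euclidean_space \<Rightarrow> real"
  assumes p: "real_polynomial_function p"
begin

lemma hessian_has_derivative: "((\<lambda>x. hessian p x u) has_derivative third_derivative p x u) (at x)"
proof -
  have "((\<lambda>x. hessian p x u) has_derivative
      (\<lambda>w. \<Sum>b\<in>Basis. (gradient (\<lambda>x. hessian p x u \<bullet> b) x \<bullet> w) *\<^sub>R b)) (at x)"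
    by (intro has_derivative_componentwiseI poly_has_derivative_gradient
        real_polynomial_function_hessian p)
  then show ?thesis
    unfolding third_derivative_def by (intro frechet_derivative_works[THEN iffD1]) (auto simp: differentiable_def)
qed

lemma third_derivative_inner:
  "third_derivative p x u v \<bullet> w = hessian (\<lambda>x. gradient p x \<bullet> w) x v \<bullet> u"
proof -
  have "((\<lambda>x. hessian p x u \<bullet> w) has_derivative (\<lambda>v. third_derivative p x u v \<bullet> w)) (at x)"
    by (intro has_derivative_inner_left hessian_has_derivative)
  moreover have "(\<lambda>x. hessian p x u \<bullet> w) = (\<lambda>x. gradient (\<lambda>x. gradient p x \<bullet> w) x \<bullet> u)"
    using hessian_inner[OF p] by blast
  moreover have "((\<lambda>x. gradient (\<lambda>x. gradient p x \<bullet> w) x \<bullet> u) has_derivative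
      (\<lambda>v. hessian (\<lambda>x. gradient p x \<bullet> w) x v \<bullet> u)) (at x)"
    by (intro has_derivative_inner_left poly_gradient_has_derivative real_polynomial_function_gradient p)
  ultimately show ?thesis
    using has_derivative_unique by metis
qed

text \<open>Symmetry of the Hessian of the polynomial \<open>gradient p x \<bullet> w\<close>. It
  moves a vector from the direction slot to the argument slot, where homogeneity and the gradient
  equation determine the result.\<close>

lemma third_derivative_commute: "third_derivative p x u v = third_derivative p x v u"
  by (rule vector_eq_rdot[THEN iffD1])
    (metis third_derivative_inner hessian_commute real_polynomial_function_gradient p)

end

section \<open>The Cartan-Muenzner equations\<close>

text \<open>The gradient equation is kept on the whole space because it is differentiated; the
  Laplacian is only evaluated on the sphere, where it is a constant. Curvatures and their
  multiplicities enter later, in \<open>dimension_eq\<close>.\<close>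

locale cartan_muenzner =
  fixes F :: "'a::euclidean_space \<Rightarrow> real" and n g :: nat and \<mu> :: real
  assumes dim: "DIM('a) = n + 2"
    and poly: "real_polynomial_function F"
    and homogeneous: "F (c *\<^sub>R x) = c ^ g * F x"
    and degree_pos: "1 \<le> g"
    and gradient_norm: "(norm (gradient F x))\<^sup>2 = (real g)\<^sup>2 * norm x powi (2 * int g - 2)"
    and laplacian_sphere: "norm x = 1 \<Longrightarrow> laplacian F x = \<mu>"
begin

abbreviation "G \<equiv> gradient F"
abbreviation "H \<equiv> hessian F"
abbreviation "T \<equiv> third_derivative F"

lemmas F_deriv = poly_has_derivative_gradient[OF poly]
  and G_deriv = poly_gradient_has_derivative[OF poly]
  and H_deriv = hessian_has_derivative[OF poly]
  and linear_H = linear_hessian[OF poly]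

lemmas H_linear = linear_add[OF linear_H] linear_diff[OF linear_H] linear_cmul[OF linear_H]

lemma selfadjoint_H: "selfadjoint (H x)"
  unfolding selfadjoint_def
  by (intro allI) (subst hessian_commute[OF poly], rule inner_commute)

lemma H_inner_commute: "H x u \<bullet> v = u \<bullet> H x v"
  using selfadjoint_H by (simp add: selfadjoint_def)

lemma T_inner_commute: "T x u v \<bullet> w = T x w v \<bullet> u"
proof -
  have "((\<lambda>x. H x u \<bullet> w) has_derivative (\<lambda>v. T x u v \<bullet> w)) (at x)"
    by (intro has_derivative_inner_left H_deriv)
  moreover have "(\<lambda>x. H x u \<bullet> w) = (\<lambda>x. H x w \<bullet> u)"
    by (rule ext) (simp add: H_inner_commute[of _ u w] inner_commute[of u])
  moreover have "((\<lambda>x. H x w \<bullet> u) has_derivative (\<lambda>v. T x w v \<bullet> u)) (at x)"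
    by (intro has_derivative_inner_left H_deriv)
  ultimately show ?thesis
    using has_derivative_unique by metis
qed

lemma linear_T: "linear (T x u)"
  using H_deriv has_derivative_linear by blast

section \<open>Differentiated forms of homogeneity and of the gradient equation\<close>

lemma euler: "G x \<bullet> x = real g * F x"
proof -
  have "((\<lambda>c. F (c *\<^sub>R x)) has_derivative (\<lambda>c. G (1 *\<^sub>R x) \<bullet> (c *\<^sub>R x))) (at 1)"
    by (rule has_derivative_compose[OF _ F_deriv]) (auto intro!: derivative_eq_intros)
  moreover have "((\<lambda>c. c ^ g * F x) has_derivative (\<lambda>c. real g * c * F x)) (at 1)"
    by (auto intro!: derivative_eq_intros)
  ultimately have "(\<lambda>c. G (1 *\<^sub>R x) \<bullet> (c *\<^sub>R x)) = (\<lambda>c. real g * c * F x)"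
    unfolding homogeneous by (rule has_derivative_unique)
  from fun_cong[OF this, of 1] show ?thesis by simp
qed

lemma H_self: "H x x = (real g - 1) *\<^sub>R G x"
proof (rule vector_eq_ldot[THEN iffD1], rule allI)
  fix v :: 'a
  have "((\<lambda>x. G x \<bullet> x) has_derivative (\<lambda>v. G x \<bullet> v + H x v \<bullet> x)) (at x)"
    by (intro has_derivative_inner G_deriv has_derivative_ident)
  moreover have "((\<lambda>x. real g * F x) has_derivative (\<lambda>v. real g * (G x \<bullet> v))) (at x)"
    by (intro has_derivative_mult_right F_deriv)
  ultimately have "(\<lambda>v. G x \<bullet> v + H x v \<bullet> x) = (\<lambda>v. real g * (G x \<bullet> v))"
    unfolding euler by (rule has_derivative_unique)
  from fun_cong[OF this, of v] show "v \<bullet> H x x = v \<bullet> (real g - 1) *\<^sub>R G x"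
    by (simp add: H_inner_commute inner_commute[of v "G x"] algebra_simps)
qed

lemma T_self: "T x x v = (real g - 2) *\<^sub>R H x v"
proof (rule vector_eq_ldot[THEN iffD1], rule allI)
  fix w
  have "((\<lambda>x. x \<bullet> H x w) has_derivative (\<lambda>v. x \<bullet> T x w v + v \<bullet> H x w)) (at x)"
    by (intro has_derivative_inner H_deriv has_derivative_ident)
  moreover have "(\<lambda>x. x \<bullet> H x w) = (\<lambda>x. (real g - 1) * (G x \<bullet> w))"
    by (simp add: H_inner_commute[symmetric] H_self)
  moreover have "((\<lambda>x. (real g - 1) * (G x \<bullet> w)) has_derivative (\<lambda>v. (real g - 1) * (H x v \<bullet> w))) (at x)"
    by (intro has_derivative_mult_right has_derivative_inner_left G_deriv)
  ultimately have "(\<lambda>v. x \<bullet> T x w v + v \<bullet> H x w) = (\<lambda>v. (real g - 1) * (H x v \<bullet> w))"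
    by (metis has_derivative_unique)
  from fun_cong[OF this, of v] have "x \<bullet> T x w v = (real g - 2) * (H x v \<bullet> w)"
    by (simp add: H_inner_commute algebra_simps)
  then show "w \<bullet> T x x v = w \<bullet> (real g - 2) *\<^sub>R H x v"
    using T_inner_commute[of x w v x] by (simp add: inner_commute[of x "T x w v"] inner_commute[of w "T x x v"] inner_commute[of w "H x v"])
qed

text \<open>The integer power of the norm becomes a natural power of \<open>x \<bullet> x\<close>, a
  polynomial that can be differentiated everywhere. The truncated exponent is correct because
  \<open>1 \<le> g\<close>.\<close>

lemma G_inner_G: "G x \<bullet> G x = (real g)\<^sup>2 * (x \<bullet> x) ^ (g - 1)"
proof -
  have "2 * int g - 2 = int (2 * (g - 1))"
    using degree_pos by simp
  then have "norm x powi (2 * int g - 2) = norm x ^ (2 * (g - 1))"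
    by (simp only: power_int_of_nat)
  also have "\<dots> = (x \<bullet> x) ^ (g - 1)"
    by (simp only: power_mult power2_norm_eq_inner)
  finally show ?thesis
    using gradient_norm[of x] by (simp only: power2_norm_eq_inner)
qed

lemma norm_sq_power_deriv:
  "((\<lambda>x::'a. (x \<bullet> x) ^ k) has_derivative (\<lambda>v. 2 * real k * (x \<bullet> x) ^ (k - 1) * (x \<bullet> v))) (at x)"
proof -
  have "((\<lambda>x::'a. x \<bullet> x) has_derivative (\<lambda>v. x \<bullet> v + v \<bullet> x)) (at x)"
    by (intro has_derivative_inner has_derivative_ident)
  then have "((\<lambda>x::'a. x \<bullet> x) has_derivative (\<lambda>v. 2 * (x \<bullet> v))) (at x)"
    by (rule has_derivative_eq_rhs) (auto simp: inner_commute)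
  from has_derivative_power[OF this, of k] show ?thesis
    by (rule has_derivative_eq_rhs) (simp add: fun_eq_iff)
qed

text \<open>Half the derivative of \<open>G_inner_G\<close>. For \<open>g = 1\<close> the exponent
  \<open>g - 2\<close> truncates, but then the factor \<open>real g - 1\<close> is zero.\<close>

lemma H_G: "H x (G x) = ((real g)\<^sup>2 * (real g - 1) * (x \<bullet> x) ^ (g - 2)) *\<^sub>R x"
proof (rule vector_eq_ldot[THEN iffD1], rule allI)
  fix v :: 'a
  have "((\<lambda>x. G x \<bullet> G x) has_derivative (\<lambda>v. G x \<bullet> H x v + H x v \<bullet> G x)) (at x)"
    by (intro has_derivative_inner G_deriv)
  moreover have "((\<lambda>x. (real g)\<^sup>2 * (x \<bullet> x) ^ (g - 1)) has_derivative
      (\<lambda>v. (real g)\<^sup>2 * (2 * real (g - 1) * (x \<bullet> x) ^ (g - 1 - 1) * (x \<bullet> v)))) (at x)"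
    by (intro has_derivative_mult_right norm_sq_power_deriv)
  ultimately have "(\<lambda>v. G x \<bullet> H x v + H x v \<bullet> G x) =
      (\<lambda>v. (real g)\<^sup>2 * (2 * real (g - 1) * (x \<bullet> x) ^ (g - 1 - 1) * (x \<bullet> v)))"
    unfolding G_inner_G by (rule has_derivative_unique)
  from fun_cong[OF this, of v]
  have "2 * (v \<bullet> H x (G x)) = 2 * ((real g)\<^sup>2 * real (g - 1) * (x \<bullet> x) ^ (g - 1 - 1) * (v \<bullet> x))"
    by (simp only: H_inner_commute inner_commute[of "G x" "H x v"] inner_commute[of x v])
  moreover have "g - 1 - 1 = g - 2"
    by simp
  ultimately show "v \<bullet> H x (G x) = v \<bullet> ((real g)\<^sup>2 * (real g - 1) * (x \<bullet> x) ^ (g - 2)) *\<^sub>R x"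
    using degree_pos by (simp only: mult_cancel_left inner_scaleR_right of_nat_diff) simp
qed

text \<open>The derivative of \<open>H_G\<close>. The gradient inside \<open>H x (G x)\<close> is
  differentiated as well, which produces the square of the Hessian.\<close>

lemma T_G:
  assumes "norm x = 1"
  shows "T x (G x) v =
    ((real g)\<^sup>2 * (real g - 1)) *\<^sub>R (v + (2 * (real g - 2) * (x \<bullet> v)) *\<^sub>R x) - H x (H x v)"
proof (rule vector_eq_ldot[THEN iffD1], rule allI)
  fix w
  have x1: "x \<bullet> x = 1"
    using assms by (simp add: norm_eq_1)
  have A: "((\<lambda>x. G x \<bullet> H x w) has_derivative (\<lambda>v. G x \<bullet> T x w v + H x v \<bullet> H x w)) (at x)"
    by (intro has_derivative_inner H_deriv G_deriv)
  have eq: "(\<lambda>x. G x \<bullet> H x w) = (\<lambda>x. (real g)\<^sup>2 * (real g - 1) * ((x \<bullet> x) ^ (g - 2) * (x \<bullet> w)))"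
    by (simp add: H_inner_commute[symmetric] H_G mult.assoc)
  have B: "((\<lambda>x. (real g)\<^sup>2 * (real g - 1) * ((x \<bullet> x) ^ (g - 2) * (x \<bullet> w))) has_derivative
     (\<lambda>v. (real g)\<^sup>2 * (real g - 1) * ((x \<bullet> x) ^ (g - 2) * (v \<bullet> w) +
        2 * real (g - 2) * (x \<bullet> x) ^ (g - 2 - 1) * (x \<bullet> v) * (x \<bullet> w)))) (at x)"
    by (intro has_derivative_mult_right has_derivative_mult norm_sq_power_deriv
        has_derivative_inner_left has_derivative_ident)
  have "(\<lambda>v. G x \<bullet> T x w v + H x v \<bullet> H x w) =
     (\<lambda>v. (real g)\<^sup>2 * (real g - 1) * ((x \<bullet> x) ^ (g - 2) * (v \<bullet> w) +
        2 * real (g - 2) * (x \<bullet> x) ^ (g - 2 - 1) * (x \<bullet> v) * (x \<bullet> w)))"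
    by (rule has_derivative_unique[OF A[unfolded eq] B])
  from fun_cong[OF this, of v]
  have "G x \<bullet> T x w v + H x v \<bullet> H x w =
      (real g)\<^sup>2 * (real g - 1) * ((v \<bullet> w) + 2 * real (g - 2) * (x \<bullet> v) * (x \<bullet> w))"
    by (simp add: x1)
  \<comment> \<open>\<open>real (g - 2)\<close> and \<open>real g - 2\<close> differ only for
    \<open>g = 1\<close>, where \<open>real g - 1\<close> vanishes.\<close>
  also have "\<dots> = (real g)\<^sup>2 * (real g - 1) * ((v \<bullet> w) + 2 * (real g - 2) * (x \<bullet> v) * (x \<bullet> w))"
    using degree_pos by (cases "g = 1") (auto simp: of_nat_diff)
  finally have "T x (G x) v \<bullet> w =
      (real g)\<^sup>2 * (real g - 1) * ((v \<bullet> w) + 2 * (real g - 2) * (x \<bullet> v) * (x \<bullet> w)) - H x (H x v) \<bullet> w"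
    using T_inner_commute[of x w v "G x"]
    by (simp add: H_inner_commute[of x "H x v" w] inner_commute[of "G x" "T x w v"])
  then show "w \<bullet> T x (G x) v = w \<bullet>
     (((real g)\<^sup>2 * (real g - 1)) *\<^sub>R (v + (2 * (real g - 2) * (x \<bullet> v)) *\<^sub>R x) - H x (H x v))"
    by (simp add: inner_commute[of w] inner_diff_left inner_add_left)
qed

lemma trace_H: "norm x = 1 \<Longrightarrow> trace_op (H x) = \<mu>"
  using laplacian_sphere by (simp add: laplacian_def trace_op_def)

section \<open>The Hessian on the plane of position vector and unit normal\<close>

definition width :: "'a \<Rightarrow> real" where
  "width x = sqrt (1 - (F x)\<^sup>2)"

text \<open>The normalized spherical gradient: by the gradient equation and Euler's relation, its
  length is \<open>real g * width x\<close>.\<close>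

definition normal :: "'a \<Rightarrow> 'a" where
  "normal x = (1 / (real g * width x)) *\<^sub>R (G x - (real g * F x) *\<^sub>R x)"

definition regular :: "'a \<Rightarrow> bool" where
  "regular x \<longleftrightarrow> norm x = 1 \<and> \<bar>F x\<bar> < 1"

text \<open>On the plane of \<open>x\<close> and \<open>normal x\<close> the Hessian is
  \<open>a\<close> times a reflection.\<close>

definition "a = real g * (real g - 1)"

context
  fixes x assumes x: "regular x"
begin

lemma x_norm: "norm x = 1" and x_inner: "x \<bullet> x = 1"
  using x by (auto simp: regular_def norm_eq_1)

lemma width_pos: "width x > 0"
  using x by (simp add: regular_def width_def abs_square_less_1)

lemma width_sq: "(width x)\<^sup>2 = 1 - (F x)\<^sup>2"
  using x abs_square_less_1[of "F x"] by (simp add: regular_def width_def less_imp_le)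

lemma G_decomp: "G x = real g *\<^sub>R (width x *\<^sub>R normal x + F x *\<^sub>R x)"
  using width_pos degree_pos by (simp add: normal_def algebra_simps)

lemma normal_inner_x: "normal x \<bullet> x = 0" "x \<bullet> normal x = 0"
  by (simp_all add: normal_def inner_diff_left inner_diff_right euler x_inner inner_commute[of x "G x"])

lemma normal_norm: "norm (normal x) = 1" "normal x \<bullet> normal x = 1"
proof -
  have "(G x - (real g * F x) *\<^sub>R x) \<bullet> (G x - (real g * F x) *\<^sub>R x) = (real g * width x)\<^sup>2"
    using G_inner_G[of x] euler[of x]
    by (simp add: inner_diff_left inner_diff_right x_inner inner_commute[of x "G x"] power_mult_distrib width_sq)
      (simp add: algebra_simps power2_eq_square)
  then show "normal x \<bullet> normal x = 1"
    using width_pos degree_pos by (simp add: normal_def power2_eq_square)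
  then show "norm (normal x) = 1"
    by (simp add: norm_eq_1)
qed

lemma H_x: "H x x = a *\<^sub>R (width x *\<^sub>R normal x + F x *\<^sub>R x)"
  by (simp add: H_self G_decomp a_def mult.commute)

lemma H_normal: "H x (normal x) = a *\<^sub>R (width x *\<^sub>R x - F x *\<^sub>R normal x)"
proof -
  let ?w = "width x" and ?t = "F x"
  have "H x (G x) = (real g * ?w) *\<^sub>R H x (normal x) + (real g * ?t) *\<^sub>R H x x"
    by (subst G_decomp) (simp add: H_linear scaleR_add_right)
  moreover have "H x (G x) = (real g * a) *\<^sub>R x"
    by (simp add: H_G x_inner a_def power2_eq_square)
  ultimately have "(real g * ?w) *\<^sub>R H x (normal x) =
      (real g * a) *\<^sub>R x - (real g * ?t * a) *\<^sub>R (?w *\<^sub>R normal x + ?t *\<^sub>R x)"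
    by (simp add: H_x)
  also have "\<dots> = (real g * a * (1 - ?t\<^sup>2)) *\<^sub>R x - (real g * ?t * a * ?w) *\<^sub>R normal x"
    by (simp add: algebra_simps power2_eq_square)
  also have "\<dots> = (real g * ?w) *\<^sub>R a *\<^sub>R (?w *\<^sub>R x - ?t *\<^sub>R normal x)"
    unfolding width_sq[symmetric] by (simp add: algebra_simps power2_eq_square)
  finally have "(real g * ?w) *\<^sub>R H x (normal x) = (real g * ?w) *\<^sub>R a *\<^sub>R (?w *\<^sub>R x - ?t *\<^sub>R normal x)" .
  then show ?thesis
    using width_pos degree_pos by (simp only: scaleR_cancel_left) simp
qed

text \<open>The reflection squares to the identity because \<open>width\<close> and \<open>F\<close>
  are the sine and cosine of one angle; hence the period two.\<close>

lemma H_pow_x: "(H x ^^ k) x =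
    (if even k then a ^ k *\<^sub>R x else a ^ k *\<^sub>R (width x *\<^sub>R normal x + F x *\<^sub>R x))"
  and H_pow_normal: "(H x ^^ k) (normal x) =
    (if even k then a ^ k *\<^sub>R normal x else a ^ k *\<^sub>R (width x *\<^sub>R x - F x *\<^sub>R normal x))"
proof -
  let ?w = "width x" and ?t = "F x" and ?n = "normal x"
  have "H x (?w *\<^sub>R ?n + ?t *\<^sub>R x) = (a * (?w\<^sup>2 + ?t\<^sup>2)) *\<^sub>R x"
    "H x (?w *\<^sub>R x - ?t *\<^sub>R ?n) = (a * (?w\<^sup>2 + ?t\<^sup>2)) *\<^sub>R ?n"
    by (simp_all add: H_linear H_x H_normal algebra_simps power2_eq_square)
  then have *: "H x (?w *\<^sub>R ?n + ?t *\<^sub>R x) = a *\<^sub>R x" "H x (?w *\<^sub>R x - ?t *\<^sub>R ?n) = a *\<^sub>R ?n"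
    by (simp_all add: width_sq)
  show "(H x ^^ k) x =
    (if even k then a ^ k *\<^sub>R x else a ^ k *\<^sub>R (?w *\<^sub>R ?n + ?t *\<^sub>R x))"
  proof (induction k)
    case (Suc k)
    then show ?case
      by (cases "even k") (simp_all add: linear_cmul[OF linear_H] * H_x mult.commute)
  qed simp
  show "(H x ^^ k) ?n =
    (if even k then a ^ k *\<^sub>R ?n else a ^ k *\<^sub>R (?w *\<^sub>R x - ?t *\<^sub>R ?n))"
  proof (induction k)
    case (Suc k)
    then show ?case
      by (cases "even k") (simp_all add: linear_cmul[OF linear_H] * H_normal mult.commute)
  qed simp
qed

lemma H_pow_x_inner: "(H x ^^ k) x \<bullet> x = a ^ k * (if even k then 1 else F x)"
  by (simp add: H_pow_x inner_add_left normal_inner_x x_inner)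

lemma H_pow_normal_inner: "(H x ^^ k) (normal x) \<bullet> normal x = a ^ k * (if even k then 1 else - F x)"
  by (simp add: H_pow_normal inner_diff_left normal_inner_x normal_norm)

lemma T_normal:
  "T x u (normal x) = (1 / (real g * width x)) *\<^sub>R
     (((real g)\<^sup>2 * (real g - 1)) *\<^sub>R (u + (2 * (real g - 2) * (x \<bullet> u)) *\<^sub>R x) - H x (H x u)
       - (real g * (real g - 2) * F x) *\<^sub>R H x u)"
proof -
  have "T x u (normal x) = (1 / (real g * width x)) *\<^sub>R (T x u (G x) - (real g * F x) *\<^sub>R T x u x)"
    unfolding normal_def by (simp add: linear_T linear_diff linear_cmul)
  then show ?thesis
    unfolding third_derivative_commute[OF poly, of x u] T_G[OF x_norm] T_self
    by (simp add: mult.assoc)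
qed

text \<open>Only the velocity at 0 matters. A great circle is chosen because it stays on the unit
  sphere, so nearby points are regular again.\<close>

definition great_circle :: "real \<Rightarrow> 'a" where
  "great_circle r = cos r *\<^sub>R x + sin r *\<^sub>R normal x"

lemma great_circle_0: "great_circle 0 = x"
  by (simp add: great_circle_def)

lemma great_circle_norm: "norm (great_circle r) = 1"
  unfolding norm_eq_1 great_circle_def
  by (simp add: inner_add_left inner_add_right x_inner normal_inner_x normal_norm
      power2_eq_square[symmetric])

lemma great_circle_deriv: "(great_circle has_vector_derivative normal x) (at 0)"
  unfolding great_circle_def has_vector_derivative_def
  by (auto intro!: derivative_eq_intros)

lemma F_great_circle_deriv:
  "((\<lambda>r. F (great_circle r)) has_real_derivative real g * width x) (at 0)"
proof -
  have "((\<lambda>r. F (great_circle r)) has_derivative (\<lambda>r. G (great_circle 0) \<bullet> (r *\<^sub>R normal x))) (at 0)"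
    using great_circle_deriv unfolding has_vector_derivative_def
    by (rule has_derivative_compose[OF _ F_deriv])
  moreover have "G x \<bullet> normal x = real g * width x"
    by (simp add: G_decomp inner_add_left normal_inner_x normal_norm)
  then have "(\<lambda>r. G (great_circle 0) \<bullet> (r *\<^sub>R normal x)) = (*) (real g * width x)"
    by (simp add: great_circle_0 fun_eq_iff)
  ultimately show ?thesis
    unfolding has_field_derivative_def by simp
qed

lemma eventually_regular: "\<forall>\<^sub>F r in at 0. regular (great_circle r)"
proof -
  have "((\<lambda>r. F (great_circle r)) \<longlongrightarrow> F (great_circle 0)) (at 0)"
    using DERIV_isCont[OF F_great_circle_deriv] by (simp add: isCont_def)
  then have "((\<lambda>r. \<bar>F (great_circle r)\<bar>) \<longlongrightarrow> \<bar>F x\<bar>) (at 0)"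
    unfolding great_circle_0 by (rule tendsto_rabs)
  then have "\<forall>\<^sub>F r in at 0. \<bar>F (great_circle r)\<bar> < 1"
    using x by (intro order_tendstoD(2)) (auto simp: regular_def)
  then show ?thesis
    by (simp add: regular_def great_circle_norm)
qed

text \<open>\<open>T_normal\<close> is quadratic in the Hessian except for a rank-one term along
  \<open>x\<close>. That term contributes \<open>x \<bullet> (H x ^^ k) x\<close>, the origin of the
  inhomogeneous term of the recursion.\<close>

lemma trace_H_pow_deriv:
  "((\<lambda>r. trace_op (H (great_circle r) ^^ Suc k)) has_real_derivative
      (1 + real k) / (real g * width x) *
       ((real g)\<^sup>2 * (real g - 1) * (trace_op (H x ^^ k)
            + 2 * (real g - 2) * a ^ k * (if even k then 1 else F x))
        - trace_op (H x ^^ Suc (Suc k)) - real g * (real g - 2) * F x * trace_op (H x ^^ Suc k))) (at 0)"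
proof -
  have T: "((\<lambda>r. H (great_circle r) u) has_vector_derivative T x u (normal x)) (at 0)" for u
  proof -
    have "((\<lambda>r. H (great_circle r) u) has_derivative (\<lambda>r. T (great_circle 0) u (r *\<^sub>R normal x))) (at 0)"
      using great_circle_deriv unfolding has_vector_derivative_def
      by (rule has_derivative_compose[OF _ H_deriv])
    then show ?thesis
      unfolding has_vector_derivative_def great_circle_0 by (simp add: linear_T linear_cmul)
  qed
  have lin: "linear (H x ^^ k)"
    by (intro linear_funpow linear_H)
  have "(H x ^^ k) (T x u (normal x)) = (1 / (real g * width x)) *\<^sub>R
     (((real g)\<^sup>2 * (real g - 1)) *\<^sub>R ((H x ^^ k) u + (2 * (real g - 2)) *\<^sub>R (u \<bullet> x) *\<^sub>R (H x ^^ k) x)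
       - (H x ^^ Suc (Suc k)) u - (real g * (real g - 2) * F x) *\<^sub>R (H x ^^ Suc k) u)" for u
    unfolding T_normal
    by (simp add: linear_add[OF lin] linear_diff[OF lin] linear_cmul[OF lin] funpow_swap1 inner_commute[of x u])
  then have "trace_op (\<lambda>u. (H x ^^ k) (T x u (normal x))) = 1 / (real g * width x) *
     ((real g)\<^sup>2 * (real g - 1) * (trace_op (H x ^^ k) + 2 * (real g - 2) * (x \<bullet> (H x ^^ k) x))
       - trace_op (H x ^^ Suc (Suc k)) - real g * (real g - 2) * F x * trace_op (H x ^^ Suc k))"
    by (simp only: trace_op_scaleR trace_op_diff trace_op_add trace_op_rank_one)
  moreover have "x \<bullet> (H x ^^ k) x = a ^ k * (if even k then 1 else F x)"
    using H_pow_x_inner[of k] by (simp add: inner_commute)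
  ultimately have "real (Suc k) * trace_op (\<lambda>u. (H x ^^ k) (T x u (normal x))) =
      (1 + real k) / (real g * width x) *
       ((real g)\<^sup>2 * (real g - 1) * (trace_op (H x ^^ k)
            + 2 * (real g - 2) * a ^ k * (if even k then 1 else F x))
        - trace_op (H x ^^ Suc (Suc k)) - real g * (real g - 2) * F x * trace_op (H x ^^ Suc k))"
    by (simp only: of_nat_Suc times_divide_eq_left times_divide_eq_right mult_1 mult_1_right mult.assoc)
  then show ?thesis
    using has_derivative_funpow_trace[where M = "\<lambda>r. H (great_circle r)" and k = "Suc k",
        OF linear_H T]
    by (simp only: great_circle_0 diff_Suc_1)
qed

end

text \<open>The second recursion taken as a definition of polynomials in the level. The step is
  indexed two below its result, so \<open>even k\<close> here is the odd case of the
  theorem.\<close>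

fun tau :: "nat \<Rightarrow> real poly" where
  "tau 0 = [:real n + 2:]"
| "tau (Suc 0) = [:\<mu>:]"
| "tau (Suc (Suc k)) =
     smult (- ((real g)\<^sup>2 / (1 + real k))) ([:1, 0, -1:] * pderiv (tau (Suc k)))
     - smult (real g * (real g - 2)) ([:0, 1:] * tau (Suc k))
     + smult ((real g)\<^sup>2 * (real g - 1)) (tau k)
     + smult (2 * (real g)\<^sup>2 * (real g - 1) * (real g - 2) * a ^ k) (if even k then 1 else [:0, 1:])"

lemma poly_tau_Suc_Suc:
  "poly (tau (Suc (Suc k))) t = - ((real g)\<^sup>2 / (1 + real k)) * (1 - t\<^sup>2) * poly (pderiv (tau (Suc k))) t
     - real g * (real g - 2) * t * poly (tau (Suc k)) t + (real g)\<^sup>2 * (real g - 1) * poly (tau k) t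
     + 2 * (real g)\<^sup>2 * (real g - 1) * (real g - 2) * a ^ k * (if even k then 1 else t)"
  by (simp add: power2_eq_square add_divide_distrib diff_divide_distrib algebra_simps)

text \<open>The formula for \<open>Suc k\<close> at all regular points gives a second expression for
  the derivative along the great circle; equating it with \<open>trace_H_pow_deriv\<close>
  determines the trace of the next power.\<close>

theorem trace_H_pow: "regular x \<Longrightarrow> trace_op (H x ^^ k) = poly (tau k) (F x)"
proof (induction k arbitrary: x rule: tau.induct)
  case 1
  then show ?case by (simp add: trace_op_id id_def dim)
next
  case 2
  then show ?case by (simp add: trace_H regular_def)
next
  case (3 k)
  let ?c = "great_circle x"
  have "((\<lambda>r. poly (tau (Suc k)) (F (?c r))) has_real_derivative
      poly (pderiv (tau (Suc k))) (F (?c 0)) * (real g * width x)) (at 0)"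
    by (rule DERIV_chain2[OF poly_DERIV F_great_circle_deriv[OF 3(4)]])
  moreover have "\<forall>\<^sub>F r in nhds 0. poly (tau (Suc k)) (F (?c r)) = trace_op (H (?c r) ^^ Suc k)"
  proof -
    have "\<forall>\<^sub>F r in at 0. poly (tau (Suc k)) (F (?c r)) = trace_op (H (?c r) ^^ Suc k)"
      using eventually_regular[OF 3(4)] by eventually_elim (simp only: 3(1))
    then show ?thesis
      using 3(1)[OF 3(4)] by (simp only: eventually_nhds_conv_at great_circle_0[OF 3(4)] simp_thms)
  qed
  ultimately have "((\<lambda>r. trace_op (H (?c r) ^^ Suc k)) has_real_derivative
      poly (pderiv (tau (Suc k))) (F x) * (real g * width x)) (at 0)"
    unfolding great_circle_0[OF 3(4)] by (rule DERIV_cong_ev[THEN iffD1, OF refl _ refl, rotated])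
  with trace_H_pow_deriv[OF 3(4), of k]
  have "(1 + real k) / (real g * width x) *
       ((real g)\<^sup>2 * (real g - 1) * (trace_op (H x ^^ k)
            + 2 * (real g - 2) * a ^ k * (if even k then 1 else F x))
        - trace_op (H x ^^ Suc (Suc k)) - real g * (real g - 2) * F x * trace_op (H x ^^ Suc k))
     = poly (pderiv (tau (Suc k))) (F x) * (real g * width x)"
    by (rule DERIV_unique)
  moreover have "z = d * u * (u / c)" if "c / u * z = d * u" "c > 0" "u > 0" for c u z d :: real
    using that by (simp add: field_simps)
  ultimately have "(real g)\<^sup>2 * (real g - 1) * (trace_op (H x ^^ k)
            + 2 * (real g - 2) * a ^ k * (if even k then 1 else F x))
        - trace_op (H x ^^ Suc (Suc k)) - real g * (real g - 2) * F x * trace_op (H x ^^ Suc k)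
     = poly (pderiv (tau (Suc k))) (F x) * (real g * width x) * ((real g * width x) / (1 + real k))"
    using width_pos[OF 3(4)] degree_pos by simp
  also have "\<dots> = (real g)\<^sup>2 / (1 + real k) * (1 - (F x)\<^sup>2) * poly (pderiv (tau (Suc k))) (F x)"
    unfolding width_sq[OF 3(4), symmetric] by (simp add: power2_eq_square)
  finally have "trace_op (H x ^^ Suc (Suc k)) =
      (real g)\<^sup>2 * (real g - 1) * (trace_op (H x ^^ k)
            + 2 * (real g - 2) * a ^ k * (if even k then 1 else F x))
      - real g * (real g - 2) * F x * trace_op (H x ^^ Suc k)
      - (real g)\<^sup>2 / (1 + real k) * (1 - (F x)\<^sup>2) * poly (pderiv (tau (Suc k))) (F x)"
    by linarith
  then show ?case
    unfolding poly_tau_Suc_Suc 3(1)[OF 3(4)] 3(3)[OF 3(4)]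
    by (simp only: distrib_left mult_minus_left mult.assoc mult.commute mult.left_commute)
qed

end

section \<open>The shape operator of the level hypersurfaces\<close>

lemma normalize_has_derivative:
  fixes x :: "'a::euclidean_space"
  assumes "norm x = 1"
  shows "((\<lambda>y. y /\<^sub>R norm y) has_derivative (\<lambda>u. u - (x \<bullet> u) *\<^sub>R x)) (at x)"
proof -
  have "x \<noteq> 0" using assms by auto
  have "(norm has_derivative (\<lambda>u. u \<bullet> sgn x)) (at x)"
    using has_derivative_norm[OF \<open>x \<noteq> 0\<close>] by simp
  from Deriv.has_derivative_inverse[OF _ this] have
    "((\<lambda>y. inverse (norm y)) has_derivative (\<lambda>u. - (x \<bullet> u))) (at x)"
    using assms by (simp add: sgn_div_norm inner_commute)
  from has_derivative_scaleR[OF this has_derivative_ident] show ?thesis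
    by (rule has_derivative_eq_rhs) (simp add: assms fun_eq_iff)
qed

text \<open>The algebra of the induction in \<open>gam_has_derivative\<close>, made polynomial by
  naming the reciprocals \<open>v\<close> of \<open>w\<close> and \<open>h\<close> of
  \<open>g\<close>. With \<open>K = k\<close>, the letters \<open>Y\<close>, \<open>X\<close>,
  \<open>A\<close> stand for \<open>gam\<close> at \<open>k - 1\<close>, \<open>k\<close>,
  \<open>Suc k\<close>, and \<open>A2\<close> for \<open>gam\<close> at \<open>k + 2\<close>; the
  suffix is the offset from \<open>i\<close>, except in \<open>A2\<close>, and \<open>m\<close>
  means \<open>i - 1\<close>. The hypotheses on \<open>Am\<close> and \<open>Y\<close> carry factors
  \<open>i\<close> and \<open>K\<close> because the predecessors truncate at 0.\<close>

lemma riccati_step: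
  fixes t w v g h K i X0 X1 X2 Xm Y0 Y1 :: real
  assumes w: "w * v = 1" "t * t = 1 - w * w" and g: "g * h = 1"
    and A0: "A0 = (t * X0 - X1 * h) * v" and A1: "A1 = (t * X1 - X2 * h) * v"
    and A2: "A2 = (t * A0 - A1 * h) * v"
    and Am: "i * Am = i * ((t * Xm - X0 * h) * v)" and Y: "K * (t * Y0 - Y1 * h) = K * (w * X0)"
    and D0: "D0 = K * (A0 + Y0) * (h * v) + i * (h * h * (v * v)) *
      (g * g * (g - 1) * Xm - X1 - g * (g - 2) * t * X0)"
    and D1: "D1 = K * (A1 + Y1) * (h * v) + (i + 1) * (h * h * (v * v)) *
      (g * g * (g - 1) * X0 - X2 - g * (g - 2) * t * X1)"
  shows "((X0 + t * D0 - D1 * h) * w - (t * X0 - X1 * h) * (- t * v)) * (v * v) =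
    (K + 1) * (A2 + X0) * (h * v) + i * (h * h * (v * v)) *
      (g * g * (g - 1) * Am - A1 - g * (g - 2) * t * A0)"
proof -
  have "t * A0 - A1 * h = w * A2"
    unfolding A2 using w(1) by algebra
  moreover have "(t * (K * (A0 + Y0)) - K * (A1 + Y1) * h) = K * (t * A0 - A1 * h) + K * (t * Y0 - Y1 * h)"
    by (simp add: algebra_simps)
  ultimately have "(t * (K * (A0 + Y0)) - K * (A1 + Y1) * h) * v = K * (A2 + X0) * (w * v)"
    unfolding Y by (simp add: algebra_simps)
  then have K: "(t * (K * (A0 + Y0)) - K * (A1 + Y1) * h) * v = K * (A2 + X0)"
    by (simp add: w(1))
  have "i * (g * g * (g - 1) * Am - A1 - g * (g - 2) * t * A0)
      = g * g * (g - 1) * (i * Am) - i * A1 - g * (g - 2) * t * (i * A0)"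
    by (simp add: algebra_simps)
  also have "\<dots> = i * ((t * (g * g * (g - 1) * Xm - X1 - g * (g - 2) * t * X0)
        - (g * g * (g - 1) * X0 - X2 - g * (g - 2) * t * X1) * h) * v)"
    unfolding Am A0 A1 by (simp add: algebra_simps)
  finally have i: "i * (g * g * (g - 1) * Am - A1 - g * (g - 2) * t * A0) = \<dots>" .
  \<comment> \<open>These terms come from differentiating the new factor and from the surplus 1 in
    \<open>i + 1\<close>; they raise \<open>K\<close> to \<open>K + 1\<close>.\<close>
  have rem: "(X0 * w + (t * X0 - X1 * h) * (t * v)) * (v * v)
      - (h * h * (v * v)) * (g * g * (g - 1) * X0 - X2 - g * (g - 2) * t * X1) * h * v
    = (A2 + X0) * (h * v)"
    unfolding A2 A0 A1 using w g by algebra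
  have "w * (v * v) = v"
    using w(1) by algebra
  moreover have "((X0 + t * D0 - D1 * h) * w - (t * X0 - X1 * h) * (- t * v)) * (v * v)
    = (X0 * w + (t * X0 - X1 * h) * (t * v)) * (v * v) + (t * D0 - D1 * h) * (w * (v * v))"
    by (simp add: algebra_simps)
  ultimately have "((X0 + t * D0 - D1 * h) * w - (t * X0 - X1 * h) * (- t * v)) * (v * v)
    = (X0 * w + (t * X0 - X1 * h) * (t * v)) * (v * v) + (t * D0 - D1 * h) * v"
    by simp
  also have "(t * D0 - D1 * h) * v = (t * (K * (A0 + Y0)) - K * (A1 + Y1) * h) * v * (h * v) +
      i * ((t * (g * g * (g - 1) * Xm - X1 - g * (g - 2) * t * X0)
        - (g * g * (g - 1) * X0 - X2 - g * (g - 2) * t * X1) * h) * v) * (h * h * (v * v))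
      - (h * h * (v * v)) * (g * g * (g - 1) * X0 - X2 - g * (g - 2) * t * X1) * h * v"
    unfolding D0 D1 by algebra
  finally show ?thesis
    unfolding K i[symmetric] using rem by (simp add: algebra_simps)
qed

context cartan_muenzner
begin

section \<open>Spherical gradient, spherical Hessian and shape operator in terms of the
  Hessian\<close>

lemma sphere_gradient_eq:
  assumes "norm x = 1"
  shows "sphere_gradient F x = G x - (real g * F x) *\<^sub>R x"
  unfolding sphere_gradient_def
proof (rule gradient_eqI)
  have "((\<lambda>y. F (y /\<^sub>R norm y)) has_derivative (\<lambda>u. G (x /\<^sub>R norm x) \<bullet> (u - (x \<bullet> u) *\<^sub>R x))) (at x)"
    by (rule has_derivative_compose[OF normalize_has_derivative[OF assms] F_deriv])
  moreover have "radial_ext F = (\<lambda>y. F (y /\<^sub>R norm y))"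
    by (simp add: radial_ext_def fun_eq_iff)
  ultimately show "(radial_ext F has_derivative (\<lambda>u. (G x - (real g * F x) *\<^sub>R x) \<bullet> u)) (at x)"
    by (simp add: assms inner_diff_left inner_diff_right euler mult.commute)
qed

text \<open>The differential of the radial projection fixes the tangent vector \<open>X\<close>, and
  pairing with \<open>Y\<close> removes the component along \<open>x\<close>.\<close>

lemma sphere_hessian_eq:
  assumes "norm x = 1" "X \<bullet> x = 0" "Y \<bullet> x = 0"
  shows "sphere_hessian F x X Y = (H x X - (real g * F x) *\<^sub>R X) \<bullet> Y"
proof -
  let ?N = "\<lambda>z. G z - (real g * F z) *\<^sub>R z"
  let ?N' = "\<lambda>u. H x u - ((real g * F x) *\<^sub>R u + (real g * (G x \<bullet> u)) *\<^sub>R x)"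
  have "(?N has_derivative ?N') (at (x /\<^sub>R norm x))"
    using assms(1) by (auto intro!: has_derivative_diff has_derivative_scaleR has_derivative_mult_right
        F_deriv G_deriv has_derivative_ident)
  then have D: "((\<lambda>y. ?N (y /\<^sub>R norm y)) has_derivative (\<lambda>u. ?N' (u - (x \<bullet> u) *\<^sub>R x))) (at x)"
    by (rule has_derivative_compose[OF normalize_has_derivative[OF assms(1)]])
  have ext: "?N (y /\<^sub>R norm y) = radial_ext (sphere_gradient F) y" if "y \<noteq> 0" for y
    using that by (simp add: radial_ext_def sphere_gradient_eq)
  have "\<forall>\<^sub>F y in at x. y \<noteq> 0"
    by (rule eventually_neq_at_within)
  then have ev: "\<forall>\<^sub>F y in at x. ?N (y /\<^sub>R norm y) = radial_ext (sphere_gradient F) y"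
    by eventually_elim (rule ext)
  have "x \<noteq> 0"
    using assms(1) by auto
  then have "(radial_ext (sphere_gradient F) has_derivative (\<lambda>u. ?N' (u - (x \<bullet> u) *\<^sub>R x))) (at x)"
    by (intro has_derivative_transform_eventually[OF D ev _ UNIV_I] ext)
  then have "frechet_derivative (radial_ext (sphere_gradient F)) (at x) = (\<lambda>u. ?N' (u - (x \<bullet> u) *\<^sub>R x))"
    by (rule frechet_derivative_at[symmetric])
  then show ?thesis
    using assms unfolding sphere_hessian_def
    by (simp add: inner_diff_left inner_add_left inner_commute[of x X] inner_commute[of x Y])
qed

text \<open>A linear extension of the shape operator to the whole space, to which the trace lemmas
  apply; \<open>shape_operator\<close> is meaningful on tangent vectors only.\<close>

definition shape :: "'a \<Rightarrow> 'a \<Rightarrow> 'a" where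
  "shape x X = (1 / width x) *\<^sub>R (F x *\<^sub>R X - (1 / real g) *\<^sub>R H x X)"

lemma linear_shape: "linear (shape x)"
  unfolding shape_def
  by (rule linearI) (simp_all add: H_linear algebra_simps)

lemma selfadjoint_shape: "selfadjoint (shape x)"
  by (simp add: selfadjoint_def shape_def inner_diff_left inner_diff_right H_inner_commute)

context
  fixes x assumes x: "regular x"
begin

lemma sphere_gradient_normal: "sphere_gradient F x = (real g * width x) *\<^sub>R normal x"
  unfolding sphere_gradient_eq[OF x_norm[OF x]] normal_def
  using width_pos[OF x] degree_pos by simp

lemma norm_sphere_gradient: "norm (sphere_gradient F x) = real g * width x"
  unfolding sphere_gradient_normal using width_pos[OF x] normal_norm[OF x] by simp

lemma level_tangent_eq: "level_tangent F x = {X. X \<bullet> x = 0 \<and> X \<bullet> normal x = 0}"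
  unfolding level_tangent_def sphere_gradient_normal
  using width_pos[OF x] degree_pos by simp

lemma subspace_level_tangent: "subspace (level_tangent F x)"
  unfolding level_tangent_eq by (rule subspace_orthogonal_pair)

lemma H_level_tangent: "X \<in> level_tangent F x \<Longrightarrow> H x X \<in> level_tangent F x"
  unfolding level_tangent_eq
  by (simp add: H_inner_commute H_x[OF x] H_normal[OF x] inner_add_right inner_diff_right)

lemma shape_level_tangent: "X \<in> level_tangent F x \<Longrightarrow> shape x X \<in> level_tangent F x"
  unfolding shape_def
  by (intro subspace_scale subspace_diff subspace_level_tangent H_level_tangent)

lemma shape_operator_eq:
  assumes X: "X \<in> level_tangent F x"
  shows "shape_operator F x X = shape x X"
proof -
  have hess: "- sphere_hessian F x X Y / norm (sphere_gradient F x) = shape x X \<bullet> Y"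
    if "Y \<in> level_tangent F x" for Y
  proof -
    have "sphere_hessian F x X Y = (H x X - (real g * F x) *\<^sub>R X) \<bullet> Y"
      using X that by (intro sphere_hessian_eq x_norm[OF x]) (auto simp: level_tangent_def)
    then show ?thesis
      unfolding norm_sphere_gradient shape_def using width_pos[OF x] degree_pos
      by (simp add: inner_diff_left field_simps)
  qed
  show ?thesis
    unfolding shape_operator_def
  proof (rule the_equality)
    fix Z assume Z: "Z \<in> level_tangent F x \<and>
      (\<forall>Y\<in>level_tangent F x. Z \<bullet> Y = - sphere_hessian F x X Y / norm (sphere_gradient F x))"
    then have "(Z - shape x X) \<bullet> Y = 0" if "Y \<in> level_tangent F x" for Y
      using hess[OF that] that by (simp add: inner_diff_left)
    then have "(Z - shape x X) \<bullet> (Z - shape x X) = 0"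
      using Z shape_level_tangent[OF X] by (blast intro: subspace_diff subspace_level_tangent)
    then show "Z = shape x X" by simp
  qed (use hess shape_level_tangent[OF X] in auto)
qed

lemma principal_space_eq:
  "principal_space F x \<kappa> = {X \<in> level_tangent F x. shape x X = \<kappa> *\<^sub>R X}"
  unfolding principal_space_def using shape_operator_eq by auto

lemma rho_shape_operator:
  "rho k (level_tangent F x) (shape_operator F x) = trace_on (level_tangent F x) (shape x ^^ k)"
  unfolding rho_def
proof (rule trace_on_cong[OF subspace_level_tangent])
  fix X assume X: "X \<in> level_tangent F x"
  have "(shape_operator F x ^^ k) X = (shape x ^^ k) X \<and> (shape x ^^ k) X \<in> level_tangent F x"
    using X by (induction k) (auto simp: shape_operator_eq shape_level_tangent)
  then show "(shape_operator F x ^^ k) X = (shape x ^^ k) X" ..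
qed

end

section \<open>Mixed traces as functions of the level\<close>

text \<open>\<open>eta i\<close> and \<open>gam k i\<close> are the traces of \<open>H\<^sup>i\<close> and \<open>L\<^sup>k H\<^sup>i\<close> on the tangent space of the level
  hypersurface, as functions of the level.  On the plane spanned by \<open>x\<close> and the normal, \<open>H\<close> has the
  eigenvalues \<open>a\<close> and \<open>-a\<close>.\<close>

definition eta :: "nat \<Rightarrow> real \<Rightarrow> real" where
  "eta i t = poly (tau i) t - a ^ i * (1 + (- 1) ^ i)"

primrec gam :: "nat \<Rightarrow> nat \<Rightarrow> real \<Rightarrow> real" where
  "gam 0 i t = eta i t"
| "gam (Suc k) i t = (t * gam k i t - gam k (Suc i) t / real g) / sqrt (1 - t\<^sup>2)"

lemma trace_on_H_pow:
  assumes x: "regular x"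
  shows "trace_on (level_tangent F x) (H x ^^ i) = eta i (F x)"
proof -
  have "trace_on (level_tangent F x) (H x ^^ i) =
      trace_op (H x ^^ i) - (H x ^^ i) x \<bullet> x - (H x ^^ i) (normal x) \<bullet> normal x"
    by (rule trace_on_orthogonal_pair)
      (auto simp: linear_funpow linear_H level_tangent_eq[OF x] x_norm[OF x] normal_norm[OF x]
        normal_inner_x[OF x])
  then show ?thesis
    by (simp add: trace_H_pow[OF x] H_pow_x_inner[OF x] H_pow_normal_inner[OF x] eta_def)
qed

lemma trace_on_shape_pow_H_pow:
  assumes x: "regular x"
  shows "trace_on (level_tangent F x) (\<lambda>X. (shape x ^^ k) ((H x ^^ i) X)) = gam k i (F x)"
proof (induction k arbitrary: i)
  case 0
  then show ?case using trace_on_H_pow[OF x] by simp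
next
  case (Suc k)
  have lin: "linear (shape x ^^ k)"
    by (intro linear_funpow linear_shape)
  have "(shape x ^^ Suc k) ((H x ^^ i) X) =
    (1 / width x) *\<^sub>R (F x *\<^sub>R (shape x ^^ k) ((H x ^^ i) X) - (1 / real g) *\<^sub>R (shape x ^^ k) ((H x ^^ Suc i) X))" for X
  proof -
    have "(shape x ^^ Suc k) ((H x ^^ i) X) = (shape x ^^ k) (shape x ((H x ^^ i) X))"
      by (simp add: funpow_swap1)
    then show ?thesis
      by (simp add: shape_def[of x "(H x ^^ i) X"] linear_diff[OF lin] linear_cmul[OF lin])
  qed
  then show ?case
    by (simp only: trace_on_scaleR trace_on_diff Suc) (simp add: width_def)
qed

lemma rho_shape_eq_gam:
  assumes "regular x"
  shows "rho k (level_tangent F x) (shape_operator F x) = gam k 0 (F x)"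
  using trace_on_shape_pow_H_pow[OF assms, of k 0] rho_shape_operator[OF assms] by simp

text \<open>The recursion of \<open>tau\<close> solved for the derivative. Removing the traces on
  the plane of \<open>x\<close> and the normal cancels the inhomogeneous term exactly.\<close>

lemma eta_has_derivative:
  assumes "\<bar>t\<bar> < 1"
  shows "(eta i has_real_derivative real i / ((real g)\<^sup>2 * (1 - t\<^sup>2)) *
    ((real g)\<^sup>2 * (real g - 1) * eta (i - 1) t - eta (Suc i) t - real g * (real g - 2) * t * eta i t)) (at t)"
proof -
  have "(eta i has_real_derivative poly (pderiv (tau i)) t) (at t)"
    unfolding eta_def by (auto intro!: derivative_eq_intros)
  moreover have "poly (pderiv (tau i)) t = real i / ((real g)\<^sup>2 * (1 - t\<^sup>2)) *
    ((real g)\<^sup>2 * (real g - 1) * eta (i - 1) t - eta (Suc i) t - real g * (real g - 2) * t * eta i t)"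
  proof (cases i)
    case 0
    then show ?thesis by simp
  next
    case (Suc k)
    have w: "1 - t\<^sup>2 > 0"
      using assms abs_square_less_1[of t] by simp
    define P where "P = poly (pderiv (tau (Suc k))) t"
    \<comment> \<open>The parity as an idempotent number, so that both cases become one polynomial
      identity.\<close>
    define e :: real where "e = (if even k then 1 else 0)"
    have sgn: "(- 1) ^ k = 2 * e - 1" "(if even k then 1 else t) = e + (1 - e) * t" and e: "e * e = e"
      by (auto simp: e_def)
    have "(real g)\<^sup>2 * (real g - 1) * eta k t - eta (Suc (Suc k)) t - real g * (real g - 2) * t * eta (Suc k) t
      = (real g)\<^sup>2 / (1 + real k) * (1 - t\<^sup>2) * P"
      unfolding eta_def poly_tau_Suc_Suc P_def[symmetric] power_Suc sgn a_def
      by (simp add: algebra_simps power2_eq_square)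
    then show ?thesis
      using w degree_pos unfolding Suc P_def[symmetric] by (simp add: field_simps)
  qed
  ultimately show ?thesis by simp
qed

lemma sqrt_1_minus_sq_has_derivative:
  "((\<lambda>t. sqrt (1 - t\<^sup>2)) has_real_derivative - t / sqrt (1 - t\<^sup>2)) (at t)" if "\<bar>t\<bar> < 1" for t :: real
  using that abs_square_less_1[of t]
  by (auto intro!: derivative_eq_intros simp: field_simps)

text \<open>The Riccati equation \<open>g w L' = 1 + L\<^sup>2\<close> for \<open>L = (t - h / g) / w\<close>, at the level of traces.\<close>

lemma gam_has_derivative:
  assumes t: "\<bar>t\<bar> < 1"
  shows "(gam k i has_real_derivative
      (real k * (gam (Suc k) i t + gam (k - 1) i t)) / (real g * sqrt (1 - t\<^sup>2)) +
      real i / ((real g)\<^sup>2 * (1 - t\<^sup>2)) *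
    ((real g)\<^sup>2 * (real g - 1) * gam k (i - 1) t - gam k (Suc i) t - real g * (real g - 2) * t * gam k i t)) (at t)"
proof (induction k arbitrary: i)
  case 0
  have "gam 0 i = eta i" for i by (rule ext) simp
  then show ?case
    using eta_has_derivative[OF t, of i] by simp
next
  case (Suc k)
  define w where "w = sqrt (1 - t\<^sup>2)"
  have w: "w > 0" "1 - t\<^sup>2 = w\<^sup>2"
    using t abs_square_less_1[of t] by (auto simp: w_def)
  have g: "real g > 0"
    using degree_pos by simp
  define D where "D i = (real k * (gam (Suc k) i t + gam (k - 1) i t)) / (real g * w) +
      real i / ((real g)\<^sup>2 * w\<^sup>2) *
    ((real g)\<^sup>2 * (real g - 1) * gam k (i - 1) t - gam k (Suc i) t - real g * (real g - 2) * t * gam k i t)" for i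
  have IH: "(gam k i has_real_derivative D i) (at t)" for i
    using Suc[of i] unfolding w_def[symmetric] unfolding w(2) D_def .
  have "((\<lambda>t. (t * gam k i t - gam k (Suc i) t / real g) / sqrt (1 - t\<^sup>2)) has_real_derivative
     ((gam k i t + t * D i - D (Suc i) / real g) * w
       - (t * gam k i t - gam k (Suc i) t / real g) * (- t / w)) / (w * w)) (at t)"
    using w(1) unfolding w_def
    by (intro DERIV_cong[OF DERIV_divide[OF DERIV_diff[OF DERIV_mult[OF DERIV_ident IH]
              DERIV_cdivide[OF IH]] sqrt_1_minus_sq_has_derivative[OF t]]])
      (auto simp: mult.commute)
  moreover have "gam (Suc k) i = (\<lambda>t. (t * gam k i t - gam k (Suc i) t / real g) / sqrt (1 - t\<^sup>2))"
    by (rule ext) simp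
  ultimately have "(gam (Suc k) i has_real_derivative
     ((gam k i t + t * D i - D (Suc i) / real g) * w
       - (t * gam k i t - gam k (Suc i) t / real g) * (- t / w)) / (w * w)) (at t)"
    by simp
  also have "((gam k i t + t * D i - D (Suc i) / real g) * w
       - (t * gam k i t - gam k (Suc i) t / real g) * (- t / w)) / (w * w)
    = (real k + 1) * (gam (Suc (Suc k)) i t + gam k i t) / (real g * w) +
      real i / ((real g)\<^sup>2 * w\<^sup>2) * ((real g)\<^sup>2 * (real g - 1) * gam (Suc k) (i - 1) t
        - gam (Suc k) (Suc i) t - real g * (real g - 2) * t * gam (Suc k) i t)"
    unfolding divide_inverse inverse_mult_distrib power2_eq_square
  proof (rule riccati_step)
    show "t * t = 1 - w * w"
      using w(2) by (simp add: power2_eq_square)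
    show "w * inverse w = 1" "real g * inverse (real g) = 1"
      using w g by simp_all
    show "real i * gam (Suc k) (i - 1) t =
        real i * ((t * gam k (i - 1) t - gam k i t * inverse (real g)) * inverse w)"
      by (cases i) (auto simp: w_def divide_inverse)
    show "real k * (t * gam (k - 1) i t - gam (k - 1) (Suc i) t * inverse (real g)) = real k * (w * gam k i t)"
      using w(1) by (cases k) (auto simp: w_def divide_inverse)
    show "D i = real k * (gam (Suc k) i t + gam (k - 1) i t) * (inverse (real g) * inverse w) +
      real i * (inverse (real g) * inverse (real g) * (inverse w * inverse w)) *
        (real g * real g * (real g - 1) * gam k (i - 1) t
          - gam k (Suc i) t - real g * (real g - 2) * t * gam k i t)"
      unfolding D_def divide_inverse inverse_mult_distrib power2_eq_square ..
    show "D (Suc i) = real k * (gam (Suc k) (Suc i) t + gam (k - 1) (Suc i) t) * (inverse (real g) * inverse w) +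
      (real i + 1) * (inverse (real g) * inverse (real g) * (inverse w * inverse w)) *
        (real g * real g * (real g - 1) * gam k i t
          - gam k (Suc (Suc i)) t - real g * (real g - 2) * t * gam k (Suc i) t)"
      unfolding D_def divide_inverse inverse_mult_distrib power2_eq_square
      by (simp only: of_nat_Suc diff_Suc_1 add.commute)
  qed (simp_all add: w_def divide_inverse)
  finally show ?case
    unfolding w_def[symmetric] unfolding w(2) by (simp only: of_nat_Suc diff_Suc_1 add.commute)
qed

text \<open>For \<open>i = 0\<close> the term with Hessian powers drops out and the recursion closes
  among the powers of the shape operator.\<close>

lemma gam_0_has_derivative:
  assumes t: "\<bar>t\<bar> < 1"
  shows "(gam k 0 has_real_derivative
      (real k * (gam (Suc k) 0 t + gam (k - 1) 0 t)) / (real g * sqrt (1 - t\<^sup>2))) (at t)"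
  using gam_has_derivative[OF t, of k 0] by simp

lemma gam_0_0: "gam 0 0 t = real n"
  by (simp add: eta_def)

lemma gam_1_0: "gam (Suc 0) 0 t = (real n * t - \<mu> / real g) / sqrt (1 - t\<^sup>2)"
  by (simp add: eta_def mult.commute)

end

section \<open>Sums of cotangents\<close>

lemma sum_cis_multiples:
  assumes "0 < g"
  shows "(\<Sum>j<g. cis (2 * pi * real e * real j / real g)) = (if g dvd e then of_nat g else 0)"
proof -
  define r where "r = cis (2 * pi * real e / real g)"
  have pow: "cis (2 * pi * real e * real j / real g) = r ^ j" for j
    by (simp add: r_def Complex.DeMoivre mult_ac)
  have "r ^ g = 1"
    using assms cis_multiple_2pi[of "real e"] by (simp add: r_def Complex.DeMoivre)
  have "r = 1 \<longleftrightarrow> g dvd e"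
  proof
    assume "r = 1"
    then have "cos (2 * pi * real e / real g) = 1"
      by (simp add: r_def complex_eq_iff)
    then obtain k :: int where "2 * pi * real e / real g = real_of_int k * 2 * pi"
      using cos_one_2pi_int[of "2 * pi * real e / real g"] by auto
    then have "real e = real_of_int k * real g"
      using assms by (simp add: field_simps)
    then have "int e = k * int g"
      by (metis of_int_eq_iff of_int_mult of_int_of_nat_eq)
    then show "g dvd e"
      by (metis dvd_triv_right int_dvd_int_iff)
  next
    assume "g dvd e"
    then obtain k where "e = g * k" ..
    then have "2 * pi * real e / real g = 2 * pi * real k"
      using assms by simp
    then show "r = 1"
      using cis_multiple_2pi[of "real k"] by (simp only: r_def Ints_of_nat)
  qed
  moreover have "(\<Sum>j<g. r ^ j) = 0" if "r \<noteq> 1"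
    using that \<open>r ^ g = 1\<close> one_diff_power_eq[of r g] by auto
  ultimately show ?thesis
    unfolding pow by auto
qed

lemma one_minus_cis_double: "1 - cis (2 * x) = - 2 * \<i> * sin x * cis x"
  by (simp add: complex_eq_iff cos_double_sin sin_double power2_eq_square)

text \<open>Reduces cotangents to \<open>1 / (1 - w)\<close> with \<open>w = cis (2 * x)\<close>,
  which has a finite geometric expansion once \<open>w ^ g\<close> is known.\<close>

lemma cot_eq_cis:
  assumes "sin x \<noteq> 0"
  shows "complex_of_real (cot x) = \<i> * (1 - 2 / (1 - cis (2 * x)))"
proof -
  have "cis (- x) = cos x - \<i> * sin x"
    by (simp add: complex_eq_iff)
  then have eq: "2 / (1 - cis (2 * x)) = \<i> * (cos x - \<i> * sin x) / sin x"
    unfolding one_minus_cis_double using assms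
    by (simp add: field_simps flip: cis_inverse)
  show ?thesis
    unfolding eq using assms by (simp add: cot_def field_simps)
qed

lemma sin_add_multiple_pi_nonzero:
  assumes "sin (real g * x) \<noteq> 0" "0 < g"
  shows "sin (x + real j * pi / real g) \<noteq> 0"
proof
  assume "sin (x + real j * pi / real g) = 0"
  then obtain k :: int where "x + real j * pi / real g = real_of_int k * pi"
    by (auto simp: sin_zero_iff_int2)
  then have "real g * x = real_of_int (int g * k - int j) * pi"
    using assms(2) by (simp add: field_simps)
  then show False
    using assms(1) sin_zero_iff_int2 by blast
qed

text \<open>Expanding \<open>1 / (1 - w)\<close> as a geometric sum of length \<open>g\<close> for \<open>w = exp (2 \<i> (x + j pi / g))\<close>,
  whose \<open>g\<close>-th power does not depend on \<open>j\<close>, reduces a sum of cotangents twisted by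
  \<open>exp (2 pi \<i> l j / g)\<close> to sums of roots of unity.\<close>

lemma sum_twisted_geometric:
  assumes x: "sin (real g * x) \<noteq> 0" and g: "0 < g" and l: "l < g"
  defines "m \<equiv> if l = 0 then 0 else g - l"
  shows "(\<Sum>j<g. cis (2 * pi * real l * real j / real g) / (1 - cis (2 * (x + real j * pi / real g))))
    = of_nat g * cis (2 * real m * x) / (1 - cis (2 * (real g * x)))"
proof -
  let ?Z = "cis (2 * (real g * x))"
  let ?w = "\<lambda>j. cis (2 * (x + real j * pi / real g))"
  have wg: "?w j ^ g = ?Z" for j
  proof -
    have "real g * (2 * (x + real j * pi / real g)) = 2 * (real g * x) + 2 * pi * real j"
      using g by (simp add: field_simps)
    then have "?w j ^ g = ?Z * cis (2 * pi * real j)"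
      by (simp only: Complex.DeMoivre cis_mult)
    then show ?thesis
      using cis_multiple_2pi[of "real j"] by (simp only: Ints_of_nat mult_1_right)
  qed
  have w1: "1 - ?w j \<noteq> 0" for j
    unfolding one_minus_cis_double using sin_add_multiple_pi_nonzero[OF x g] by simp
  have Z1: "1 - ?Z \<noteq> 0"
    unfolding one_minus_cis_double using x by simp
  have geo: "1 / (1 - ?w j) = (\<Sum>i<g. ?w j ^ i) / (1 - ?Z)" for j
    using one_diff_power_eq[of "?w j" g] w1[of j] Z1 unfolding wg by (simp add: field_simps)
  have "(\<Sum>j<g. cis (2 * pi * real l * real j / real g) / (1 - ?w j))
    = (\<Sum>j<g. \<Sum>i<g. cis (2 * pi * real l * real j / real g) * ?w j ^ i) / (1 - ?Z)"
  proof -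
    have "cis (2 * pi * real l * real j / real g) / (1 - ?w j)
      = (\<Sum>i<g. cis (2 * pi * real l * real j / real g) * ?w j ^ i) / (1 - ?Z)" for j
      using geo[of j] by (simp add: sum_distrib_left[symmetric] divide_inverse mult.assoc)
    then show ?thesis
      by (simp add: sum_divide_distrib)
  qed
  also have "(\<Sum>j<g. \<Sum>i<g. cis (2 * pi * real l * real j / real g) * ?w j ^ i)
    = (\<Sum>i<g. \<Sum>j<g. cis (2 * real i * x) * cis (2 * pi * real (l + i) * real j / real g))"
  proof (subst sum.swap, intro sum.cong refl)
    fix i j
    show "cis (2 * pi * real l * real j / real g) * ?w j ^ i =
       cis (2 * real i * x) * cis (2 * pi * real (l + i) * real j / real g)"
      unfolding Complex.DeMoivre cis_mult
      by (rule arg_cong[where f = cis]) (simp add: algebra_simps add_divide_distrib)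
  qed
  also have "\<dots> = (\<Sum>i<g. cis (2 * real i * x) * (if g dvd l + i then of_nat g else 0))"
    unfolding sum_distrib_left[symmetric] sum_cis_multiples[OF g] ..
  \<comment> \<open>As \<open>l + i < 2 * g\<close>, divisibility leaves only
    \<open>l + i = 0\<close> or \<open>l + i = g\<close>, which is the single index
    \<open>m\<close>.\<close>
  also have "\<dots> = (\<Sum>i<g. if i = m then cis (2 * real m * x) * of_nat g else 0)"
  proof (intro sum.cong refl)
    fix i assume "i \<in> {..<g}"
    then have "g dvd l + i \<longleftrightarrow> i = m"
    proof -
      assume i: "i \<in> {..<g}"
      have "i = m" if dvd: "g dvd l + i"
      proof -
        obtain q where q: "l + i = g * q" using dvd by (rule dvdE)
        have "g * q < g * 2" unfolding q[symmetric] using i l by simp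
        then have "q = 0 \<or> q = 1" by auto
        then show ?thesis using q i l by (auto simp: m_def)
      qed
      moreover have "g dvd l + m"
        using l by (auto simp: m_def)
      ultimately show ?thesis by blast
    qed
    then show "cis (2 * real i * x) * (if g dvd l + i then of_nat g else 0)
       = (if i = m then cis (2 * real m * x) * of_nat g else 0)" by simp
  qed
  also have "\<dots> = of_nat g * cis (2 * real m * x)"
    using l g by (auto simp: m_def)
  finally show ?thesis .
qed

lemma sum_cot:
  assumes x: "sin (real g * x) \<noteq> 0" and g: "0 < g"
  shows "(\<Sum>j<g. cot (x + real j * pi / real g)) = real g * cot (real g * x)"
proof -
  have "complex_of_real (\<Sum>j<g. cot (x + real j * pi / real g))
    = \<i> * (of_nat g - 2 * (\<Sum>j<g. 1 / (1 - cis (2 * (x + real j * pi / real g)))))"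
    by (simp add: cot_eq_cis[OF sin_add_multiple_pi_nonzero[OF x g]] sum_distrib_left[symmetric] sum_subtractf
        sum_divide_distrib[symmetric] sum_distrib_left)
  also have "\<dots> = of_nat g * (\<i> * (1 - 2 / (1 - cis (2 * (real g * x)))))"
    using sum_twisted_geometric[OF x g g] by (simp add: algebra_simps)
  also have "\<dots> = complex_of_real (real g * cot (real g * x))"
    by (simp add: cot_eq_cis[OF x])
  finally show ?thesis
    using of_real_eq_iff by blast
qed

lemma sum_alternating: "even g \<Longrightarrow> (\<Sum>j<g. (- 1 :: 'a::comm_ring_1) ^ j) = 0"
proof (induction g rule: nat_less_induct)
  case (1 g)
  show ?case
  proof (cases g)
    case (Suc h)
    with 1 obtain k where "g = Suc (Suc k)" "even k"
      by (cases h) auto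
    with 1 show ?thesis by simp
  qed simp
qed

text \<open>For even \<open>g\<close> the signs are the twist with \<open>l = g / 2\<close>, and
  then \<open>m = g / 2\<close> too. The factor \<open>cis (real g * x)\<close> cancels against
  \<open>one_minus_cis_double\<close>, leaving the reciprocal sine.\<close>

lemma sum_alternating_cot:
  assumes x: "sin (real g * x) \<noteq> 0" and g: "0 < g" and even: "even g"
  shows "(\<Sum>j<g. (- 1) ^ j * cot (x + real j * pi / real g)) = real g / sin (real g * x)"
proof -
  obtain l where l: "g = 2 * l"
    using even by blast
  have sgn: "(- 1) ^ j = cis (2 * pi * real l * real j / real g)" for j
  proof -
    have "cis pi ^ j = cis (2 * pi * real l * real j / real g)"
      unfolding Complex.DeMoivre using g by (intro arg_cong[where f = cis]) (simp add: l)
    then show ?thesis by simp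
  qed
  have "complex_of_real (\<Sum>j<g. (- 1) ^ j * cot (x + real j * pi / real g))
    = \<i> * ((\<Sum>j<g. (- 1) ^ j) - 2 * (\<Sum>j<g. (- 1) ^ j / (1 - cis (2 * (x + real j * pi / real g)))))"
  proof -
    have "complex_of_real ((- 1) ^ j * cot (x + real j * pi / real g))
      = \<i> * ((- 1) ^ j - 2 * ((- 1) ^ j / (1 - cis (2 * (x + real j * pi / real g)))))" for j
      by (simp only: of_real_mult of_real_power of_real_minus of_real_1
          cot_eq_cis[OF sin_add_multiple_pi_nonzero[OF x g]]) (simp add: algebra_simps)
    then show ?thesis
      by (simp only: of_real_sum sum_distrib_left[symmetric] sum_subtractf)
  qed
  also have "\<dots> = - 2 * \<i> * (of_nat g * cis (real g * x)) / (1 - cis (2 * (real g * x)))"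
  proof -
    have "l < g" "l \<noteq> 0" "2 * real (g - l) = real g"
      using g l by auto
    with sum_twisted_geometric[OF x g, of l]
    have "(\<Sum>j<g. (- 1) ^ j / (1 - cis (2 * (x + real j * pi / real g))))
       = of_nat g * cis (real g * x) / (1 - cis (2 * (real g * x)))"
      unfolding sgn by simp
    then show ?thesis
      by (simp only: sum_alternating[OF even]) simp
  qed
  also have "\<dots> = complex_of_real (real g / sin (real g * x))"
    unfolding one_minus_cis_double using x by (simp add: field_simps)
  finally show ?thesis
    using of_real_eq_iff by blast
qed

lemma cot_strict_antimono:
  assumes "0 < x" "x < y" "y < pi"
  shows "cot y < (cot x :: real)"
proof -
  have "sin x > 0" "sin y > 0" "sin (y - x) > 0"
    using assms by (auto intro: sin_gt_zero)
  then have "cot x - cot y = sin (y - x) / (sin x * sin y)"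
    by (simp add: cot_def sin_diff field_simps)
  moreover have "\<dots> > 0"
    using \<open>sin x > 0\<close> \<open>sin y > 0\<close> \<open>sin (y - x) > 0\<close> by simp
  ultimately show ?thesis by simp
qed

section \<open>Multiplicities of the principal curvatures\<close>

context cartan_muenzner
begin

text \<open>For odd degree \<open>F\<close> is odd and so is its Hessian, yet the trace is the same
  at \<open>x\<close> and \<open>- x\<close>.\<close>

lemma trace_zero_if_odd_degree:
  assumes "odd g"
  shows "\<mu> = 0"
proof -
  obtain x :: 'a where x: "norm x = 1"
    using norm_Basis nonempty_Basis by blast
  have "F (- x) = - F x" for x
    using homogeneous[of "-1" x] assms by simp
  then have Fm: "(\<lambda>x. F (- x)) = (\<lambda>x. - F x)" by blast
  have Gm: "G (- x) = G x" for x
  proof (rule vector_eq_ldot[THEN iffD1], rule allI)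
    fix u
    have "((\<lambda>x. F (- x)) has_derivative (\<lambda>u. G (- x) \<bullet> (- u))) (at x)"
      by (rule has_derivative_compose[OF _ F_deriv]) (auto intro!: derivative_eq_intros)
    moreover have "((\<lambda>x. F (- x)) has_derivative (\<lambda>u. - (G x \<bullet> u))) (at x)"
      unfolding Fm by (intro has_derivative_minus F_deriv)
    ultimately have "(\<lambda>u. G (- x) \<bullet> (- u)) = (\<lambda>u. - (G x \<bullet> u))"
      by (rule has_derivative_unique)
    from fun_cong[OF this, of u] show "u \<bullet> G (- x) = u \<bullet> G x"
      by (simp add: inner_commute)
  qed
  have Hm: "H (- x) u = - H x u" for u
  proof -
    have "((\<lambda>x. G (- x)) has_derivative (\<lambda>u. H (- x) (- u))) (at x)"
      by (rule has_derivative_compose[OF _ G_deriv]) (auto intro!: derivative_eq_intros)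
    moreover have "((\<lambda>x. G (- x)) has_derivative H x) (at x)"
      unfolding Gm using G_deriv by simp
    ultimately have "(\<lambda>u. H (- x) (- u)) = H x"
      by (rule has_derivative_unique)
    from fun_cong[OF this, of u] show ?thesis
      by (simp add: linear_neg[OF linear_H] neg_eq_iff_add_eq_0 eq_neg_iff_add_eq_0)
  qed
  have "trace_op (H (- x)) = - trace_op (H x)"
    unfolding Hm[abs_def] trace_op_minus[symmetric] by (rule arg_cong[where f = trace_op]) (simp add: Hm fun_eq_iff)
  then show ?thesis
    using trace_H[OF x] trace_H[of "- x"] x by simp
qed

text \<open>With \<open>t = cos (g * \<theta>)\<close> these are the cotangents of
  \<open>\<theta> + j * pi / g\<close>; each solves the scalar Riccati equation that the shape
  operator satisfies.\<close>

definition curvature :: "nat \<Rightarrow> real \<Rightarrow> real" where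
  "curvature j t = cot (arccos t / real g + real j * pi / real g)"

text \<open>Fitted to the zeroth and first trace: the constant part pairs with
  \<open>sum_cot\<close>, the alternating part with \<open>sum_alternating_cot\<close>. For odd
  \<open>g\<close> all weights agree since \<open>\<mu> = 0\<close>.\<close>

definition weight :: "nat \<Rightarrow> real" where
  "weight j = (real n - (- 1) ^ j * (\<mu> / real g)) / real g"

lemma curvature_angle:
  assumes "\<bar>t\<bar> < 1" "j < g"
  shows "0 < arccos t / real g + real j * pi / real g" "arccos t / real g + real j * pi / real g < pi"
proof -
  have ac: "0 < arccos t" "arccos t < pi"
    using arccos_lt_bounded[of t] assms(1) by auto
  have eq: "arccos t / real g + real j * pi / real g = (arccos t + real j * pi) / real g"
    by (simp add: add_divide_distrib)
  show "0 < arccos t / real g + real j * pi / real g"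
    using ac degree_pos by (intro add_pos_nonneg) auto
  have "arccos t + real j * pi < (1 + real j) * pi"
    using ac by (simp add: algebra_simps)
  also have "\<dots> \<le> real g * pi"
    using assms(2) by (intro mult_right_mono) auto
  finally show "arccos t / real g + real j * pi / real g < pi"
    unfolding eq using degree_pos by (simp add: pos_divide_less_eq mult.commute)
qed

lemma curvature_strict_antimono:
  assumes "\<bar>t\<bar> < 1" "i < j" "j < g"
  shows "curvature j t < curvature i t"
  unfolding curvature_def
  using curvature_angle[OF assms(1), of i] curvature_angle[OF assms(1,3)] assms degree_pos
  by (intro cot_strict_antimono) (auto simp: divide_strict_right_mono)

lemma curvature_has_derivative:
  assumes "\<bar>t\<bar> < 1" "j < g"
  shows "(curvature j has_real_derivative (1 + (curvature j t)\<^sup>2) / (real g * sqrt (1 - t\<^sup>2))) (at t)"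
proof -
  let ?x = "arccos t / real g + real j * pi / real g"
  have sin: "sin ?x \<noteq> 0"
    using sin_gt_zero[OF curvature_angle[OF assms]] by simp
  have "((\<lambda>t. arccos t / real g + real j * pi / real g) has_real_derivative
      inverse (- sqrt (1 - t\<^sup>2)) / real g) (at t)"
    using assms(1)
    by (intro DERIV_cong[OF DERIV_add[OF DERIV_cdivide[OF DERIV_arccos] DERIV_const]]) auto
  from DERIV_chain2[OF DERIV_cot[OF sin] this]
  have "((\<lambda>t. cot (arccos t / real g + real j * pi / real g)) has_real_derivative
      - inverse ((sin ?x)\<^sup>2) * (inverse (- sqrt (1 - t\<^sup>2)) / real g)) (at t)" .
  moreover have "inverse ((sin ?x)\<^sup>2) = 1 + (cot ?x)\<^sup>2"
    using sin sin_cos_squared_add[of ?x] by (simp add: cot_def power_divide field_simps)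
  ultimately show ?thesis
    unfolding curvature_def by (simp add: divide_inverse mult_ac)
qed

lemma sum_weight_curvature_0: "(\<Sum>j<g. weight j) = real n"
proof (cases "even g")
  case True
  have "(\<Sum>j<g. weight j) = (real g * real n - (\<Sum>j<g. (- 1) ^ j) * (\<mu> / real g)) / real g"
    by (simp add: weight_def sum_subtractf sum_divide_distrib[symmetric] sum_distrib_right)
  then show ?thesis
    using sum_alternating[OF True, where 'a = real] degree_pos by simp
next
  case False
  then have \<mu>: "\<mu> = 0"
    by (intro trace_zero_if_odd_degree) simp
  have "weight j = real n / real g" for j
    unfolding weight_def by (simp add: \<mu>)
  then show ?thesis
    using degree_pos by simp
qed

lemma sum_weight_curvature_1:
  assumes "\<bar>t\<bar> < 1"
  shows "(\<Sum>j<g. weight j * curvature j t) = (real n * t - \<mu> / real g) / sqrt (1 - t\<^sup>2)"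
proof -
  let ?x = "arccos t / real g"
  have w: "sqrt (1 - t\<^sup>2) > 0"
    using assms abs_square_less_1[of t] by simp
  have x: "real g * ?x = arccos t" and sc: "sin (arccos t) = sqrt (1 - t\<^sup>2)" "cos (arccos t) = t"
    using assms degree_pos by (auto simp: sin_arccos cos_arccos)
  have s: "sin (real g * ?x) \<noteq> 0"
    unfolding x sc using w by simp
  have S1: "(\<Sum>j<g. curvature j t) = real g * (t / sqrt (1 - t\<^sup>2))"
    using sum_cot[OF s] degree_pos unfolding curvature_def x by (simp add: cot_def sc)
  have "(\<Sum>j<g. weight j * curvature j t) =
    (\<Sum>j<g. real n / real g * curvature j t - \<mu> / (real g)\<^sup>2 * ((- 1) ^ j * curvature j t))"
    by (intro sum.cong refl) (simp add: weight_def power2_eq_square field_simps)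
  also have "\<dots> = real n / real g * (\<Sum>j<g. curvature j t) - \<mu> / (real g)\<^sup>2 * (\<Sum>j<g. (- 1) ^ j * curvature j t)"
    by (simp add: sum_subtractf sum_distrib_left)
  also have "\<dots> = (real n * t - \<mu> / real g) / sqrt (1 - t\<^sup>2)"
  proof (cases "even g")
    case True
    have "(\<Sum>j<g. (- 1) ^ j * curvature j t) = real g / sqrt (1 - t\<^sup>2)"
      using sum_alternating_cot[OF s _ True] degree_pos unfolding curvature_def x by (simp add: sc)
    then show ?thesis
      unfolding S1 using degree_pos by (simp add: diff_divide_distrib power2_eq_square)
  next
    case False
    then show ?thesis
      unfolding S1 using degree_pos trace_zero_if_odd_degree by simp
  qed
  finally show ?thesis .
qed

text \<open>Both sides satisfy the same recursion in \<open>k\<close>.\<close>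

lemma gam_eq_sum_curvature:
  "\<bar>t\<bar> < 1 \<Longrightarrow> gam k 0 t = (\<Sum>j<g. weight j * curvature j t ^ k)"
proof (induction k arbitrary: t rule: less_induct)
  case (less k)
  consider "k = 0" | "k = 1" | l where "k = Suc (Suc l)"
    by (metis One_nat_def not0_implies_Suc)
  then show ?case
  proof cases
    case 1
    then show ?thesis by (simp add: gam_0_0 sum_weight_curvature_0 del: gam.simps)
  next
    case 2
    then show ?thesis
      using sum_weight_curvature_1[OF less.prems] gam_1_0[of t] by (simp del: gam.simps)
  next
    case 3
    let ?R = "\<lambda>k t. \<Sum>j<g. weight j * curvature j t ^ k"
    let ?w = "sqrt (1 - t\<^sup>2)"
    \<comment> \<open>Needed on the whole interval, because the equality for \<open>Suc l\<close> is
      differentiated.\<close>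
    have IH: "gam (Suc l) 0 t = ?R (Suc l) t" "gam l 0 t = ?R l t" if "\<bar>t\<bar> < 1" for t
      using less.IH[OF _ that] 3 by (auto simp del: gam.simps)
    have "(?R (Suc l) has_real_derivative
       (\<Sum>j<g. weight j * (real (Suc l) * curvature j t ^ l * ((1 + (curvature j t)\<^sup>2) / (real g * ?w))))) (at t)"
      by (intro DERIV_sum DERIV_cmult DERIV_cong[OF DERIV_power[OF curvature_has_derivative[OF less.prems]]])
        auto
    moreover have "(\<Sum>j<g. weight j * (real (Suc l) * curvature j t ^ l * ((1 + (curvature j t)\<^sup>2) / (real g * ?w))))
        = real (Suc l) * (?R k t + ?R l t) / (real g * ?w)"
      unfolding 3 sum.distrib[symmetric] sum_distrib_left sum_divide_distrib
      by (intro sum.cong refl) (simp add: power2_eq_square algebra_simps)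
    ultimately have "(?R (Suc l) has_real_derivative real (Suc l) * (?R k t + ?R l t) / (real g * ?w)) (at t)"
      by simp
    moreover have "(?R (Suc l) has_real_derivative real (Suc l) * (gam k 0 t + gam l 0 t) / (real g * ?w)) (at t)"
    proof (rule has_field_derivative_transform_within_open)
      show "(gam (Suc l) 0 has_real_derivative real (Suc l) * (gam k 0 t + gam l 0 t) / (real g * ?w)) (at t)"
        using gam_0_has_derivative[OF less.prems, of "Suc l"] 3 by (simp only: diff_Suc_1)
      show "open {-1<..<1::real}" "t \<in> {-1<..<1}"
        using less.prems by auto
    qed (use IH(1) in auto)
    ultimately have "real (Suc l) * (?R k t + ?R l t) / (real g * ?w)
        = real (Suc l) * (gam k 0 t + gam l 0 t) / (real g * ?w)"
      by (rule DERIV_unique)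
    moreover have "?w > 0"
      using less.prems abs_square_less_1[of t] by simp
    ultimately have "?R k t + ?R l t = gam k 0 t + gam l 0 t"
      using degree_pos by simp
    then show ?thesis
      using IH(2)[OF less.prems] by simp
  qed
qed

text \<open>The polynomial with all \<open>c j\<close> as roots annihilates the tangent space, so
  every curvature is some \<open>c j\<close>, and \<open>card K = g\<close> makes all of them occur.
  By monotonicity the extremes are \<open>c 0\<close> and \<open>c (g - 1)\<close>, with
  multiplicities given by their weights. Adding these cancels \<open>\<mu>\<close>: the signs are
  opposite for even \<open>g\<close>, and \<open>\<mu> = 0\<close> for odd \<open>g\<close>.\<close>

lemma dimension_eq:
  assumes x: "regular x" and K: "principal_curvatures F x = K" "card K = g"
    and m1: "dim (principal_space F x (Max K)) = m1" and m2: "dim (principal_space F x (Min K)) = m2"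
  shows "2 * real n = real g * (real m1 + real m2)"
proof -
  let ?V = "level_tangent F x" and ?L = "shape x"
  define c where "c j = curvature j (F x)" for j
  have t: "\<bar>F x\<bar> < 1"
    using x by (simp add: regular_def)
  have tr: "trace_on ?V (?L ^^ k) = (\<Sum>j<g. weight j * c j ^ k)" for k
    using rho_shape_operator[OF x, of k] rho_shape_eq_gam[OF x, of k] gam_eq_sum_curvature[OF t]
    by (simp add: c_def)
  have anti: "c j < c i" if "i < j" "j < g" for i j
    using curvature_strict_antimono[OF t that] by (simp add: c_def)
  have inj: "inj_on c {..<g}"
    by (intro linorder_inj_onI) (use anti in \<open>force+\<close>)
  have "K \<subseteq> c ` {..<g}"
  proof
    fix \<kappa> assume "\<kappa> \<in> K"
    then obtain X where X: "X \<in> ?V" "?L X = \<kappa> *\<^sub>R X" "X \<noteq> 0"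
      using K(1) by (auto simp: principal_curvatures_def principal_space_eq[OF x])
    have "root_product (map c [0..<g]) ?L X = 0"
      by (rule root_product_eq_0[OF linear_shape selfadjoint_shape subspace_level_tangent[OF x] _ tr])
        (use X shape_level_tangent[OF x] in auto)
    then have "prod_list (map (\<lambda>a. \<kappa> - a) (map c [0..<g])) = 0"
      using root_product_eigenvector[OF linear_shape X(2)] X(3) by simp
    then show "\<kappa> \<in> c ` {..<g}"
      by (auto simp: prod_list_zero_iff)
  qed
  then have Kc: "K = c ` {..<g}"
    using K(2) card_image[OF inj] by (intro card_subset_eq) auto
  have le: "c j \<le> c i" if "i \<le> j" "j < g" for i j
    using anti[of i j] that by (cases "i = j") auto
  have "Max K = c 0" "Min K = c (g - 1)"
    unfolding Kc using degree_pos le by (auto intro!: Max_eqI Min_eqI)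
  moreover have "real (dim (principal_space F x (c i))) = weight i" if "i < g" for i
    unfolding principal_space_eq[OF x]
    by (rule dim_eigenspace_root_product[OF linear_shape selfadjoint_shape subspace_level_tangent[OF x] _ tr])
      (use that inj shape_level_tangent[OF x] in auto)
  ultimately have "real m1 = weight 0" "real m2 = weight (g - 1)"
    using m1 m2 degree_pos by auto
  then have "real g * (real m1 + real m2) = 2 * real n - (1 + (- 1) ^ (g - 1)) * (\<mu> / real g)"
    using degree_pos by (simp add: weight_def field_simps)
  also have "(1 + (- 1) ^ (g - 1)) * (\<mu> / real g) = 0"
    using trace_zero_if_odd_degree degree_pos by (cases "odd g") auto
  finally show ?thesis by simp
qed

end

section \<open>From Cartan polynomials to the recursions\<close>

lemma level_value_eqI:
  assumes "level_hypersurface f t \<noteq> {}" "\<And>x. x \<in> level_hypersurface f t \<Longrightarrow> h x = q"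
  shows "level_value f h t = q"
  unfolding level_value_def using assms by (intro the_equality) auto

lemma cartan_polynomial_imp_cartan_muenzner:
  fixes F :: "'a::euclidean_space \<Rightarrow> real"
  assumes "DIM('a) = n + 2" "cartan_polynomial F g m1 m2"
  shows "cartan_muenzner F n g ((real g)\<^sup>2 / 2 * (real m2 - real m1))"
proof
  have hom: "\<forall>c x. F (c *\<^sub>R x) = c ^ g * F x"
    and ne: "\<forall>t\<in>{-1<..<1}. level_hypersurface F t \<noteq> {}"
    using assms(2) by (auto simp: cartan_polynomial_def)
  show "1 \<le> g"
  proof (rule ccontr)
    assume "\<not> 1 \<le> g"
    then have "g = 0" by simp
    \<comment> \<open>Homogeneity with \<open>c = 0\<close>, where \<open>0 ^ 0 = 1\<close>.\<close>
    then have const: "F x = F 0" for x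
      using hom[rule_format, of 0 x] by simp
    have "level_hypersurface F 0 \<noteq> {}" "level_hypersurface F (1 / 2) \<noteq> {}"
      using ne by auto
    then obtain x y where "F x = 0" "F y = 1 / 2"
      by (auto simp: level_hypersurface_def)
    then show False
      using const[of x] const[of y] by simp
  qed
qed (use assms in \<open>auto simp: cartan_polynomial_def\<close>)

lemma sqrt_ratio:
  fixes t :: real
  assumes "\<bar>t\<bar> < 1"
  shows "sqrt ((1 + t) / (1 - t)) = (1 + t) / sqrt (1 - t\<^sup>2)"
proof -
  have "sqrt (1 - t\<^sup>2) = sqrt (1 + t) * sqrt (1 - t)"
    by (simp add: real_sqrt_mult[symmetric] algebra_simps power2_eq_square)
  moreover have "sqrt (1 + t) * sqrt (1 + t) = 1 + t" "sqrt (1 + t) > 0" "sqrt (1 - t) > 0"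
    using assms by auto
  ultimately show ?thesis
    by (simp add: real_sqrt_divide field_simps)
qed

theorem theorem2p1:
  fixes F :: "real ^ 'N \<Rightarrow> real" and n g m1 m2 :: nat
  assumes "CARD('N) = n + 2"
    and "cartan_polynomial F g m1 m2"
  shows "\<forall>t\<in>{-1<..<1}.
      (\<forall>k. \<forall>x\<in>level_hypersurface F t.
         rho k (level_tangent F x) (shape_operator F x) = Q F k t \<and>
         rho k UNIV (hessian F x) = rho_bar F k t) \<and>
      Q F 0 t = real n \<and>
      Q F 1 t = real m1 * real g / 2 * sqrt ((1 + t) / (1 - t))
                - real m2 * real g / 2 * sqrt ((1 - t) / (1 + t)) \<and>
      (\<forall>k\<in>{1..n - 1}.
         Q F k differentiable (at t) \<and>
         Q F (k + 1) t =
           real g / real k * sqrt (1 - t\<^sup>2) * deriv (Q F k) t - Q F (k - 1) t) \<and>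
      rho_bar F 0 t = real n + 2 \<and>
      rho_bar F 1 t = (real g)\<^sup>2 / 2 * (real m2 - real m1) \<and>
      (\<forall>k\<in>{1..n - 1}.
         rho_bar F k differentiable (at t) \<and>
         rho_bar F (k + 1) t =
           - ((real g)\<^sup>2 / real k) * (1 - t\<^sup>2) * deriv (rho_bar F k) t
           - real g * (real g - 2) * t * rho_bar F k t
           + (real g)\<^sup>2 * (real g - 1) * rho_bar F (k - 1) t
           + (if odd k
              then 2 * real g ^ (k + 1) * (real g - 1) ^ k * (real g - 2)
              else 2 * real g ^ (k + 1) * (real g - 1) ^ k * (real g - 2) * t))"
proof -
  define \<mu> where "\<mu> = (real g)\<^sup>2 / 2 * (real m2 - real m1)"
  interpret cartan_muenzner F n g \<mu>
    unfolding \<mu>_def using assms by (intro cartan_polynomial_imp_cartan_muenzner) auto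
  have ne: "level_hypersurface F t \<noteq> {}" if "\<bar>t\<bar> < 1" for t
    using assms(2) that by (auto simp: cartan_polynomial_def abs_less_iff)
  have reg: "regular x" "F x = t" if "x \<in> level_hypersurface F t" "\<bar>t\<bar> < 1" for x t
    using that by (auto simp: level_hypersurface_def regular_def)
  have rho: "rho k (level_tangent F x) (shape_operator F x) = gam k 0 t"
    and rhobar: "rho k UNIV (hessian F x) = poly (tau k) t"
    if "x \<in> level_hypersurface F t" "\<bar>t\<bar> < 1" for x t k
    using rho_shape_eq_gam[OF reg(1)[OF that]] trace_H_pow[OF reg(1)[OF that]] reg(2)[OF that]
    by (simp_all add: rho_def trace_on_UNIV linear_funpow linear_H del: gam.simps)
  have Q: "Q F k t = gam k 0 t" if "\<bar>t\<bar> < 1" for k t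
    unfolding Q_def using ne[OF that] rho[OF _ that] by (rule level_value_eqI)
  have bar: "rho_bar F k t = poly (tau k) t" if "\<bar>t\<bar> < 1" for k t
    unfolding rho_bar_def using ne[OF that] rhobar[OF _ that] by (rule level_value_eqI)
  have dim: "2 * real n = real g * (real m1 + real m2)"
  proof -
    \<comment> \<open>A point of a single level suffices, since the relation does not involve
      \<open>t\<close>.\<close>
    obtain x where x: "x \<in> level_hypersurface F 0"
      using ne[of 0] by auto
    obtain K where "card K = g" "\<forall>x\<in>level_hypersurface F 0. principal_curvatures F x = K \<and>
        dim (principal_space F x (Max K)) = m1 \<and> dim (principal_space F x (Min K)) = m2"
      using assms(2) unfolding cartan_polynomial_def
      by (elim conjE) (drule bspec[where x = 0], simp, blast)
    then show ?thesis
      using x reg(1)[OF x] by (intro dimension_eq[of x K]) auto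
  qed
  \<comment> \<open>\<open>Q\<close> and \<open>rho_bar\<close> are identified only for levels in
    the open interval, so derivatives are transferred there.\<close>
  have deriv_cong: "(f has_real_derivative d) (at t)"
    if "\<And>t. \<bar>t\<bar> < 1 \<Longrightarrow> f t = h t" "(h has_real_derivative d) (at t)" "\<bar>t\<bar> < 1" for f h :: "real \<Rightarrow> real" and d t
    by (rule has_field_derivative_transform_within_open[OF that(2), of "{-1<..<1}"])
      (use that in \<open>auto simp: abs_less_iff\<close>)
  show ?thesis
  proof (intro ballI conjI allI)
    fix t :: real assume "t \<in> {-1<..<1}"
    then have t: "\<bar>t\<bar> < 1" by auto
    fix k x assume "x \<in> level_hypersurface F t"
    then show "rho k (level_tangent F x) (shape_operator F x) = Q F k t"
      "rho k UNIV (hessian F x) = rho_bar F k t"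
      using rho rhobar Q bar t by auto
  next
    fix t :: real assume "t \<in> {-1<..<1}"
    then have t: "\<bar>t\<bar> < 1" by auto
    have w: "sqrt (1 - t\<^sup>2) > 0"
      using t abs_square_less_1[of t] by simp
    show "Q F 0 t = real n"
      unfolding Q[OF t] by (rule gam_0_0)
    have Q1: "Q F 1 t = (real n * t - \<mu> / real g) / sqrt (1 - t\<^sup>2)"
      unfolding Q[OF t] One_nat_def by (rule gam_1_0)
    \<comment> \<open>The dimension relation enters here: it splits the numerator into the parts
      belonging to \<open>m1\<close> and \<open>m2\<close>.\<close>
    have num: "real n * t - \<mu> / real g = real m1 * real g / 2 * (1 + t) - real m2 * real g / 2 * (1 - t)"
    proof -
      have "\<mu> / real g = real g / 2 * (real m2 - real m1)"
        using degree_pos by (simp add: \<mu>_def power2_eq_square)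
      moreover have "real n = real g * (real m1 + real m2) / 2"
        using dim by simp
      ultimately show ?thesis
        by (simp add: algebra_simps add_divide_distrib diff_divide_distrib)
    qed
    have ratio: "sqrt ((1 - t) / (1 + t)) = (1 - t) / sqrt (1 - t\<^sup>2)"
      using sqrt_ratio[of "- t"] t by simp
    show "Q F 1 t = real m1 * real g / 2 * sqrt ((1 + t) / (1 - t))
                - real m2 * real g / 2 * sqrt ((1 - t) / (1 + t))"
      unfolding Q1 num ratio sqrt_ratio[OF t]
      by (simp only: diff_divide_distrib[of "real m1 * real g / 2 * (1 + t)"] times_divide_eq_right)
    show "rho_bar F 0 t = real n + 2" "rho_bar F 1 t = (real g)\<^sup>2 / 2 * (real m2 - real m1)"
      unfolding bar[OF t] \<mu>_def[symmetric] by simp_all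
    fix k assume k: "k \<in> {1..n - 1}"
    then obtain l where l: "k = Suc l"
      by (cases k) auto
    have dQ: "(Q F k has_real_derivative
        (real k * (gam (Suc k) 0 t + gam (k - 1) 0 t)) / (real g * sqrt (1 - t\<^sup>2))) (at t)"
      by (rule deriv_cong[OF Q gam_0_has_derivative[OF t] t])
    then show "Q F k differentiable (at t)"
      using real_differentiable_def by blast
    show "Q F (k + 1) t = real g / real k * sqrt (1 - t\<^sup>2) * deriv (Q F k) t - Q F (k - 1) t"
      unfolding DERIV_imp_deriv[OF dQ] Q[OF t] using w k degree_pos by (simp del: gam.simps)
    have dB: "(rho_bar F k has_real_derivative poly (pderiv (tau k)) t) (at t)"
      by (rule deriv_cong[OF bar poly_DERIV t])
    then show "rho_bar F k differentiable (at t)"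
      using real_differentiable_def by blast
    \<comment> \<open>With \<open>k = Suc l\<close> the parity flips, and the factors outside
      \<open>a ^ l\<close> raise the exponents of \<open>g\<close> and \<open>g - 1\<close> to
      \<open>k + 1\<close> and \<open>k\<close>.\<close>
    have force: "2 * (real g)\<^sup>2 * (real g - 1) * (real g - 2) * a ^ l * (if even l then 1 else t) =
        (if odd k then 2 * real g ^ (k + 1) * (real g - 1) ^ k * (real g - 2)
         else 2 * real g ^ (k + 1) * (real g - 1) ^ k * (real g - 2) * t)"
      unfolding l a_def power_mult_distrib by (simp add: power2_eq_square)
    show "rho_bar F (k + 1) t =
           - ((real g)\<^sup>2 / real k) * (1 - t\<^sup>2) * deriv (rho_bar F k) t
           - real g * (real g - 2) * t * rho_bar F k t
           + (real g)\<^sup>2 * (real g - 1) * rho_bar F (k - 1) t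
           + (if odd k
              then 2 * real g ^ (k + 1) * (real g - 1) ^ k * (real g - 2)
              else 2 * real g ^ (k + 1) * (real g - 1) ^ k * (real g - 2) * t)"
      unfolding DERIV_imp_deriv[OF dB] bar[OF t] force[symmetric]
      unfolding l Suc_eq_plus1[symmetric] poly_tau_Suc_Suc diff_Suc_1 of_nat_Suc by (rule refl)
  qed
qed

end
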